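(* Let $\mathrm{XASM}$ be one of the seven symmetry classes $\mathrm{ASM}$, $\mathrm{VSASM}$, $\mathrm{VHSASM}$, $\mathrm{HTSASM}$, $\mathrm{DSASM}$, $\mathrm{DASASM}$, $\mathrm{TSASM}$ (that is, any dihedral symmetry class other than the quarter-turn class), and let $n$ be an admissible size, i.e., a positive integer for which at least one $n\times n$ $\mathrm{XASM}$ exists. Then $P_{\mathrm{XASM}}\subseteq\mathbb R^{n\times n}$ has the integer Carathéodory property. If $\mathrm{XASM}$ is non-trivial (i.e., not the class $\mathrm{ASM}$) and $C$ is its set of core positions, then $P^{\mathrm{core}}_{\mathrm{XASM}}\subseteq\mathbb R^{C}$ also has the integer Carathéodory property. Consequently, all these polytopes have the integer decomposition property.
   Context: $[n]=\{1,\dots,n\}$. An $n\times n$ alternating sign matrix (ASM) is an $n\times n$ matrix with entries in $\{0,1,-1\}$ such that in each row and each column the non-zero entries alternate in sign and the first and last non-zero entries are $1$ (so every row and column sums to $1$). Symmetry classes are sets of $n\times n$ ASMs $X=(x_{i,j})$ satisfying, for all $i,j\in[n]$: ASM (no further condition); VSASM: $x_{i,j}=x_{i,n+1-j}$; VHSASM: $x_{i,j}=x_{i,n+1-j}=x_{n+1-i,j}$; HTSASM: $x_{i,j}=x_{n+1-i,n+1-j}$; DSASM: $x_{i,j}=x_{j,i}$; DASASM: $x_{i,j}=x_{j,i}=x_{n+1-j,n+1-i}$; TSASM: $x_{i,j}=x_{i,n+1-j}=x_{j,i}$. $P_{\mathrm{XASM}}$ is the convex hull in $\mathbb R^{n\times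 n}$ of all $n\times n$ XASMs. Core positions, with $k=\lfloor n/2\rfloor$: VSASM: $C=[n]\times[k]$; VHSASM: $C=[k]\times[k]$; HTSASM: $C=[n]\times[k]$ if $n$ is even and $C=([n]\times[k])\cup([k]\times\{k+1\})$ if $n$ is odd; DSASM: $C=\{(i,j)\in[n]\times[n]: i\le j\}$; DASASM: $C=\{(i,j)\in[k]\times[n]: i\le j\le n+1-i\}$; TSASM: $C=\{(i,j)\in[k]\times[k]: i\le j\}$. (VSASMs, VHSASMs and TSASMs exist only for odd $n$.) $P^{\mathrm{core}}_{\mathrm{XASM}}\subseteq\mathbb R^C$ is the convex hull of the restrictions $(x_{i,j})_{(i,j)\in C}$ of all $n\times n$ XASMs $X$. A polyhedron $Q\subseteq\mathbb R^d$ has the integer Carathéodory property if for every positive integer $r$ and every $x\in rQ\cap\mathbb Z^d$ there are affinely independent points $v_1,\dots,v_m\in Q\cap\mathbb Z^d$ and positive integers $\lambda_1,\dots,\lambda_m$ with $x=\sum_{i=1}^m\lambda_iv_i$ and $\sum_{i=1}^m\lambda_i=r$. It has the integer decomposition property if for every positive integer $r$ every $x\in rQ\cap\mathbb Z^d$ is a sum of $r$ (not necessarily distinct) points of $Q\cap\mathbb Z^d$. For full-matrix polytopes integer points are taken in $\mathbb Z^{n\times n}$, for core polytopes in $\mathbb Z^C$. *)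

theory Defs
  imports "HOL-Analysis.Analysis" "HOL-Library.Function_Algebras"
begin

text \<open>
  For a finite index set \<open>I\<close>, the space \<open>\<real>\<^sup>I\<close> is the space of functions \<open>'i \<Rightarrow> real\<close> that vanish
  outside \<open>I\<close>.  The pointwise real vector space structure makes \<^term>\<open>convex hull S\<close> and
  \<^const>\<open>affine_dependent\<close> available; inside the subspace \<open>\<real>\<^sup>I\<close> they have their usual meaning.
\<close>

instantiation "fun" :: (type, real_vector) real_vector
begin

definition scaleR_fun :: "real \<Rightarrow> ('a \<Rightarrow> 'b) \<Rightarrow> 'a \<Rightarrow> 'b"
  where "scaleR_fun a f = (\<lambda>i. a *\<^sub>R f i)"

instance
  by intro_classes
     (simp_all add: fun_eq_iff scaleR_fun_def scaleR_add_right scaleR_add_left)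

end

definition int_lattice :: "'i set \<Rightarrow> ('i \<Rightarrow> real) set"
  where "int_lattice I = {x. (\<forall>i\<in>I. x i \<in> \<int>) \<and> (\<forall>i. i \<notin> I \<longrightarrow> x i = 0)}"

definition restrict0 :: "'i set \<Rightarrow> ('i \<Rightarrow> real) \<Rightarrow> 'i \<Rightarrow> real"
  where "restrict0 I x = (\<lambda>i. if i \<in> I then x i else 0)"

text \<open>
  In both properties below \<open>Q\<close> is a subset of \<open>\<real>\<^sup>I\<close>.  Affinely independent points are pairwise
  distinct, so they form a finite set \<open>V\<close>.
\<close>

definition integer_caratheodory :: "'i set \<Rightarrow> ('i \<Rightarrow> real) set \<Rightarrow> bool"
  where "integer_caratheodory I Q \<longleftrightarrow>
    (\<forall>r::nat. r > 0 \<longrightarrow> (\<forall>x \<in> (\<lambda>q. real r *\<^sub>R q) ` Q \<inter> int_lattice I.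
      \<exists>(V :: ('i \<Rightarrow> real) set) (c :: ('i \<Rightarrow> real) \<Rightarrow> nat).
        finite V \<and> V \<subseteq> Q \<inter> int_lattice I \<and> \<not> affine_dependent V \<and>
        (\<forall>v\<in>V. c v > 0) \<and> x = (\<Sum>v\<in>V. real (c v) *\<^sub>R v) \<and> (\<Sum>v\<in>V. c v) = r))"

definition integer_decomposition :: "'i set \<Rightarrow> ('i \<Rightarrow> real) set \<Rightarrow> bool"
  where "integer_decomposition I Q \<longleftrightarrow>
    (\<forall>r::nat. r > 0 \<longrightarrow> (\<forall>x \<in> (\<lambda>q. real r *\<^sub>R q) ` Q \<inter> int_lattice I.
      \<exists>v :: nat \<Rightarrow> 'i \<Rightarrow> real. (\<forall>k<r. v k \<in> Q \<inter> int_lattice I) \<and> x = (\<Sum>k<r. v k)))"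

text \<open>
  An \<open>n \<times> n\<close> matrix is a function on pairs of naturals, with rows and columns indexed by
  \<open>1, \<dots>, n\<close> and value \<open>0\<close> off this square.
\<close>

type_synonym matr = "nat \<times> nat \<Rightarrow> real"

definition square :: "nat \<Rightarrow> (nat \<times> nat) set"
  where "square n = {1..n} \<times> {1..n}"

definition alternating :: "real list \<Rightarrow> bool"
  where "alternating xs \<longleftrightarrow>
    (let ys = filter (\<lambda>a. a \<noteq> 0) xs
     in ys \<noteq> [] \<and> hd ys = 1 \<and> last ys = 1 \<and> successively (\<lambda>a b. sgn b = - sgn a) ys)"

definition is_ASM :: "nat \<Rightarrow> matr \<Rightarrow> bool"
  where "is_ASM n x \<longleftrightarrow>
    (\<forall>p \<in> square n. x p \<in> {0, 1, -1}) \<and> (\<forall>p. p \<notin> square n \<longrightarrow> x p = 0) \<and>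
    (\<forall>i \<in> {1..n}. alternating (map (\<lambda>j. x (i, j)) [1..<Suc n])) \<and>
    (\<forall>j \<in> {1..n}. alternating (map (\<lambda>i. x (i, j)) [1..<Suc n]))"

datatype symmetry_class = ASM | VSASM | VHSASM | HTSASM | DSASM | DASASM | TSASM

fun has_symmetry :: "symmetry_class \<Rightarrow> nat \<Rightarrow> matr \<Rightarrow> bool" where
  "has_symmetry ASM n x \<longleftrightarrow> True"
| "has_symmetry VSASM n x \<longleftrightarrow>
     (\<forall>i\<in>{1..n}. \<forall>j\<in>{1..n}. x (i, j) = x (i, n + 1 - j))"
| "has_symmetry VHSASM n x \<longleftrightarrow>
     (\<forall>i\<in>{1..n}. \<forall>j\<in>{1..n}. x (i, j) = x (i, n + 1 - j) \<and> x (i, j) = x (n + 1 - i, j))"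
| "has_symmetry HTSASM n x \<longleftrightarrow>
     (\<forall>i\<in>{1..n}. \<forall>j\<in>{1..n}. x (i, j) = x (n + 1 - i, n + 1 - j))"
| "has_symmetry DSASM n x \<longleftrightarrow>
     (\<forall>i\<in>{1..n}. \<forall>j\<in>{1..n}. x (i, j) = x (j, i))"
| "has_symmetry DASASM n x \<longleftrightarrow>
     (\<forall>i\<in>{1..n}. \<forall>j\<in>{1..n}. x (i, j) = x (j, i) \<and> x (i, j) = x (n + 1 - j, n + 1 - i))"
| "has_symmetry TSASM n x \<longleftrightarrow>
     (\<forall>i\<in>{1..n}. \<forall>j\<in>{1..n}. x (i, j) = x (i, n + 1 - j) \<and> x (i, j) = x (j, i))"

definition XASMs :: "symmetry_class \<Rightarrow> nat \<Rightarrow> matr set"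
  where "XASMs X n = {x. is_ASM n x \<and> has_symmetry X n x}"

text \<open>The core is only defined for the non-trivial classes; the value for \<^const>\<open>ASM\<close> is a dummy.\<close>

fun core :: "symmetry_class \<Rightarrow> nat \<Rightarrow> (nat \<times> nat) set" where
  "core ASM n = square n"
| "core VSASM n = {1..n} \<times> {1..n div 2}"
| "core VHSASM n = {1..n div 2} \<times> {1..n div 2}"
| "core HTSASM n =
     (if even n then {1..n} \<times> {1..n div 2}
      else {1..n} \<times> {1..n div 2} \<union> {1..n div 2} \<times> {n div 2 + 1})"
| "core DSASM n = {(i, j). (i, j) \<in> {1..n} \<times> {1..n} \<and> i \<le> j}"
| "core DASASM n = {(i, j). (i, j) \<in> {1..n div 2} \<times> {1..n} \<and> i \<le> j \<and> j \<le> n + 1 - i}"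
| "core TSASM n = {(i, j). (i, j) \<in> {1..n div 2} \<times> {1..n div 2} \<and> i \<le> j}"

definition P_full :: "symmetry_class \<Rightarrow> nat \<Rightarrow> matr set"
  where "P_full X n = convex hull (XASMs X n)"

definition P_core :: "symmetry_class \<Rightarrow> nat \<Rightarrow> matr set"
  where "P_core X n = convex hull (restrict0 (core X n) ` XASMs X n)"

end

theory Submission
  imports Defs
begin

text \<open>
  Corner sums \<open>c i j\<close> turn alternating sign matrices into the integer points of a system of
  difference constraints \<open>0 \<le> c (i + 1) j - c i j \<le> 1\<close>, \<open>0 \<le> c i (j + 1) - c i j \<le> 1\<close>
  with fixed boundary.  Such systems are stable under rounding: if \<open>c\<close> is an integer solution
  of the \<open>r\<close>-fold dilated system, then every \<open>\<lfloor>(c + t) / r\<rfloor>\<close>, \<open>0 \<le> t < r\<close>, solves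
  the original one, and by Hermite's identity they add up to \<open>c\<close>.  Transposition and half-turn
  symmetry survive the rounding; for a reflection the floors are replaced by ceilings beyond the axis,
  next to which the corner sums of the symmetric integer points are forced.  Each coordinate changes
  at most once as \<open>t\<close> runs through \<open>0, \<dots>, r - 1\<close>, so the distinct roundings are affinely
  independent.  The core polytopes inherit the result because every entry is an integer affine function
  of the core entries.
\<close>

section \<open>Affine independence of points listed in a chain\<close>

text \<open>A dependence with \<open>U a = 0\<close> is already one on \<open>S\<close>; otherwise
  it can be solved for \<open>a\<close>, which writes \<open>a\<close> as an affine combination of
  \<open>S\<close>.\<close>

lemma affine_independent_insert_outside_hull:
  fixes a :: "'a::real_vector"
  assumes "finite S" "a \<notin> affine hull S" "\<not> affine_dependent S"
  shows "\<not> affine_dependent (insert a S)"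
proof
  assume "affine_dependent (insert a S)"
  then obtain U where U: "sum U (insert a S) = 0" "\<exists>v\<in>insert a S. U v \<noteq> 0"
      "(\<Sum>v\<in>insert a S. U v *\<^sub>R v) = 0"
    using assms(1) by (auto simp: affine_dependent_explicit_finite)
  have a: "a \<notin> S" using assms(2) by (meson hull_inc)
  have s: "U a + sum U S = 0" "U a *\<^sub>R a + (\<Sum>v\<in>S. U v *\<^sub>R v) = 0"
    using U(1,3) a assms(1) by auto
  show False
  proof (cases "U a = 0")
    case True
    then show False using s U(2) assms(1,3) by (auto simp: affine_dependent_explicit_finite)
  next
    case False
    have "(\<Sum>v\<in>S. (- U v / U a)) = 1"
      using s(1) False by (simp add: sum_divide_distrib[symmetric] sum_negf field_simps)
    moreover have "(\<Sum>v\<in>S. (- U v / U a) *\<^sub>R v) = a"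
    proof -
      have "(\<Sum>v\<in>S. (- U v / U a) *\<^sub>R v) = (- 1 / U a) *\<^sub>R (\<Sum>v\<in>S. U v *\<^sub>R v)"
        by (simp add: scaleR_sum_right sum_negf)
      also have "(\<Sum>v\<in>S. U v *\<^sub>R v) = - (U a *\<^sub>R a)"
        using s(2) by (simp add: eq_neg_iff_add_eq_0 add.commute)
      finally show ?thesis using False by simp
    qed
    ultimately have "a \<in> affine hull S"
      using assms(1) by (force simp: affine_hull_finite)
    then show False using assms(2) by simp
  qed
qed

text \<open>Points are added one at a time. If \<open>v r\<close> is new, it differs from its
  predecessor, so some functional \<open>L p\<close> jumps there. By \<open>once\<close> this
  functional was constant before, so its level set contains the affine hull of the earlier points
  but misses \<open>v r\<close>. Repetitions in the list are harmless because the claim concerns the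
  image set.\<close>

lemma chain_affine_independent:
  fixes v :: "nat \<Rightarrow> 'a::real_vector" and L :: "'p \<Rightarrow> 'a \<Rightarrow> real"
  assumes lin: "\<And>p. linear (L p)"
    and inj: "\<And>s t. s < r \<Longrightarrow> t < r \<Longrightarrow> (\<And>p. L p (v s) = L p (v t)) \<Longrightarrow> v s = v t"
    and once: "\<And>p s t. Suc t < r \<Longrightarrow> s \<le> t \<Longrightarrow> L p (v (Suc t)) \<noteq> L p (v t) \<Longrightarrow>
       L p (v s) = L p (v t)"
  shows "\<not> affine_dependent (v ` {..<r})"
  using inj once
proof (induction r)
  case 0
  then show ?case by simp
next
  case (Suc r)
  have IH: "\<not> affine_dependent (v ` {..<r})"
    by (rule Suc.IH) (use Suc.prems less_SucI in blast)+
  show ?case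
  proof (cases "v r \<in> v ` {..<r}")
    case True
    then show ?thesis using IH by (simp add: lessThan_Suc insert_absorb)
  next
    case False
    show ?thesis
    proof (cases r)
      case 0
      then show ?thesis by (simp add: lessThan_Suc affine_independent_1)
    next
      case (Suc m)
      have "v (Suc m) \<noteq> v m" using False Suc by force
      then obtain p where p: "L p (v (Suc m)) \<noteq> L p (v m)"
        using Suc.prems(1)[of "Suc m" m] Suc by auto
      have "L p (v s) = L p (v m)" if "s < r" for s
        using Suc.prems(2)[of m s p] p Suc that by simp
      then have "v ` {..<r} \<subseteq> {x. L p x = L p (v m)}" by blast
      moreover have "affine {x. L p x = L p (v m)}"
        unfolding affine_def
        by (simp add: linear_add[OF lin] linear_scale[OF lin] flip: distrib_right)
      ultimately have "affine hull (v ` {..<r}) \<subseteq> {x. L p x = L p (v m)}"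
        by (rule hull_minimal)
      then have "v r \<notin> affine hull (v ` {..<r})" using p Suc by auto
      then show ?thesis using affine_independent_insert_outside_hull[OF _ _ IH] by (simp add: lessThan_Suc)
    qed
  qed
qed

section \<open>Rounding and Hermite's identity\<close>

text \<open>For \<open>s = 1\<close> this is the floor of \<open>(a + t) / r\<close>, for
  \<open>s = -1\<close> the ceiling of \<open>(a - t) / r\<close>. Carrying the sign as a parameter
  lets one set of lemmas serve both sides of a reflection axis.\<close>

definition rnd :: "nat \<Rightarrow> real \<Rightarrow> nat \<Rightarrow> real \<Rightarrow> real"
  where "rnd r s t a = s * of_int \<lfloor>(s * a + real t) / real r\<rfloor>"

lemma rnd_uminus: "rnd r (- s) t (- a) = - rnd r s t a"
  by (simp add: rnd_def)

lemma rnd_shift: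
  assumes "r > 0" "s \<in> {1, -1}"
  shows "rnd r s t (a + real r * of_int m) = rnd r s t a + of_int m"
proof -
  have "(a + real r * of_int m + real t) / real r = (a + real t) / real r + of_int m"
    using assms(1) by (simp add: field_simps)
  moreover have "(- a - real r * of_int m + real t) / real r = (- a + real t) / real r - of_int m"
    using assms(1) by (simp add: field_simps)
  ultimately show ?thesis using assms by (auto simp: rnd_def)
qed

lemma rnd_mult:
  assumes "t < r" "s \<in> {1, -1}"
  shows "rnd r s t (real r * of_int m) = of_int m"
proof -
  have "rnd r s t 0 = 0" using assms(1) by (simp add: rnd_def floor_eq_iff)
  then show ?thesis using rnd_shift[of r s t 0 m] assms by simp
qed

lemma rnd_mono:
  assumes "a \<le> b" "s \<in> {1, -1}"
  shows "rnd r s t a \<le> rnd r s t b"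
  using assms by (auto simp: rnd_def intro!: floor_mono divide_right_mono)

lemma rnd_Ints: "s \<in> {1, -1} \<Longrightarrow> rnd r s t a \<in> \<int>"
  by (auto simp: rnd_def)

text \<open>Between \<open>u\<close> and \<open>Suc t\<close> the numerator grows by less than
  \<open>r\<close>, so the floor rises by at most one in total. If that rise happens in the last
  step, nothing changed before.\<close>

lemma rnd_changes_once:
  assumes "Suc t < r" "u \<le> t" "rnd r s (Suc t) a \<noteq> rnd r s t a"
  shows "rnd r s u a = rnd r s t a"
proof -
  define f where "f t = \<lfloor>(s * a + real t) / real r\<rfloor>" for t
  have mono: "f t \<le> f t'" if "t \<le> t'" for t t'
    unfolding f_def using that by (auto intro!: floor_mono divide_right_mono)
  have "(s * a + real (Suc t)) / real r \<le> (s * a + real u) / real r + 1"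
    using assms(1) divide_right_mono[of "s * a + real (Suc t)" "s * a + real u + real r" "real r"]
    by (simp add: add_divide_distrib)
  then have "f (Suc t) \<le> \<lfloor>(s * a + real u) / real r + 1\<rfloor>"
    unfolding f_def by (rule floor_mono)
  then have "f (Suc t) \<le> f u + 1" by (simp add: f_def)
  moreover have "f (Suc t) \<noteq> f t" using assms(3) by (auto simp: rnd_def f_def)
  ultimately have "f u = f t" using mono[of u t] mono[of t "Suc t"] assms(2) by simp
  then show ?thesis by (simp add: rnd_def f_def)
qed

text \<open>Hermite's identity for integers. With \<open>a = r q + u\<close> and
  \<open>0 \<le> u < r\<close>, exactly the \<open>u\<close> shifts \<open>t \<ge> r - u\<close>
  yield \<open>q + 1\<close>, all others yield \<open>q\<close>.\<close>

lemma sum_div_shifts: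
  fixes a :: int
  assumes "r > 0"
  shows "(\<Sum>t<r. (a + int t) div int r) = a"
proof -
  define q u where "q = a div int r" and "u = nat (a mod int r)"
  have a: "a = int r * q + int u" and u: "u < r"
    using assms by (auto simp: q_def u_def nat_less_iff)
  have "(a + int t) div int r = q + (if t \<in> {r - u..<r} then 1 else 0)" if "t < r" for t
  proof (cases "t \<in> {r - u..<r}")
    case True
    have "(a + int t) div int r = (int u + int t - int r + (q + 1) * int r) div int r"
      by (simp add: a algebra_simps)
    also have "\<dots> = q + 1"
      using assms u True that by (subst div_mult_self1) (auto simp: div_pos_pos_trivial)
    finally show ?thesis using True by simp
  next
    case False
    have "(a + int t) div int r = (int u + int t + q * int r) div int r"
      by (simp add: a algebra_simps)
    also have "\<dots> = q"
      using assms u False that by (subst div_mult_self1) (auto simp: div_pos_pos_trivial)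
    finally show ?thesis using False by simp
  qed
  then have "(\<Sum>t<r. (a + int t) div int r) = (\<Sum>t<r. q + (if t \<in> {r - u..<r} then 1 else 0))"
    by (intro sum.cong) auto
  also have "\<dots> = int r * q + int (card ({..<r} \<inter> {r - u..<r}))"
    by (simp add: sum.distrib sum.If_cases del: atLeastLessThan_iff)
  also have "{..<r} \<inter> {r - u..<r} = {r - u..<r}" by auto
  finally show ?thesis using a u by simp
qed

lemma sum_rnd:
  assumes "r > 0" "s \<in> {1, -1}" "a \<in> \<int>"
  shows "(\<Sum>t<r. rnd r s t a) = a"
proof -
  obtain b where b: "s * a = of_int b" using assms(2,3) by (auto elim!: Ints_cases)
     (metis of_int_minus)
  have "\<lfloor>(s * a + real t) / real r\<rfloor> = (b + int t) div int r" for t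
    unfolding b by (metis floor_divide_of_int_eq of_int_add of_int_of_nat_eq)
  then have "(\<Sum>t<r. rnd r s t a) = s * of_int (\<Sum>t<r. (b + int t) div int r)"
    by (simp add: rnd_def sum_distrib_left)
  also have "\<dots> = s * (s * a)" using sum_div_shifts[OF assms(1)] b by simp
  finally show ?thesis using assms(2) by auto
qed

section \<open>Alternation in terms of partial sums\<close>

text \<open>The nonzero entries alternate starting with 1 exactly when the running sum moves between
  0 and 1, and this sum then records the sign of the last nonzero entry. The condition on the last
  entry is kept in a separate conjunct because a proper prefix may end in -1; the induction needs
  all three conjuncts.\<close>

lemma alternating_prefix_sums:
  fixes f :: "nat \<Rightarrow> real" and n :: nat
  defines "ys \<equiv> \<lambda>n. filter (\<lambda>a. a \<noteq> 0) (map f [1..<Suc n])"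
  assumes "\<forall>j\<in>{1..n}. f j \<in> {0, 1, -1}"
  shows "((ys n \<noteq> [] \<longrightarrow> hd (ys n) = 1) \<and> successively (\<lambda>a b. sgn b = - sgn a) (ys n) \<longleftrightarrow>
      (\<forall>m\<le>n. sum f {1..m} \<in> {0, 1})) \<and>
    set (ys n) \<subseteq> {1, -1} \<and>
    ((\<forall>m\<le>n. sum f {1..m} \<in> {0, 1}) \<longrightarrow> (sum f {1..n} = 1 \<longleftrightarrow> ys n \<noteq> [] \<and> last (ys n) = 1))"
  using assms(2)
proof (induction n)
  case 0
  then show ?case by (simp add: ys_def)
next
  case (Suc n)
  have IH: "((ys n \<noteq> [] \<longrightarrow> hd (ys n) = 1) \<and> successively (\<lambda>a b. sgn b = - sgn a) (ys n) \<longleftrightarrow>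
      (\<forall>m\<le>n. sum f {1..m} \<in> {0, 1}))" "set (ys n) \<subseteq> {1, -1}"
    "((\<forall>m\<le>n. sum f {1..m} \<in> {0, 1}) \<longrightarrow> (sum f {1..n} = 1 \<longleftrightarrow> ys n \<noteq> [] \<and> last (ys n) = 1))"
    using Suc by auto
  define P S where "P \<longleftrightarrow> (\<forall>m\<le>n. sum f {1..m} \<in> {0, 1})" and "S = sum f {1..n}"
  note IH' = IH[folded P_def S_def]
  have y: "ys (Suc n) = ys n @ (if f (Suc n) = 0 then [] else [f (Suc n)])"
    by (simp add: ys_def)
  have al: "(\<forall>m\<le>Suc n. sum f {1..m} \<in> {0, 1}) \<longleftrightarrow>
     (\<forall>m\<le>n. sum f {1..m} \<in> {0, 1}) \<and> S + f (Suc n) \<in> {0, 1}"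
    by (auto simp: le_Suc_eq S_def)
  have l: "ys n \<noteq> [] \<Longrightarrow> last (ys n) = 1 \<or> last (ys n) = -1"
    using IH(2) last_in_set by fastforce
  have sm: "sum f {1..Suc n} = S + f (Suc n)" by (simp add: S_def)
  have f: "f (Suc n) = 0 \<or> f (Suc n) = 1 \<or> f (Suc n) = -1" using Suc.prems by auto
  have m: "P \<Longrightarrow> S = 0 \<or> S = 1" by (auto simp: P_def S_def)
  show ?case
    using f
  proof (elim disjE)
    assume "f (Suc n) = 0"
    then show ?thesis unfolding al sm y P_def[symmetric] using IH' m by (cases P) simp_all
  next
    assume a: "f (Suc n) = 1"
    show ?thesis
    proof (cases "ys n = []")
      case True
      then show ?thesis unfolding al sm y P_def[symmetric] using a IH' m by (cases P) simp_all
    next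
      case False
      then show ?thesis unfolding al sm y P_def[symmetric] using a IH' m l by (cases P) (auto simp: successively_append_iff)
    qed
  next
    assume a: "f (Suc n) = -1"
    show ?thesis
    proof (cases "ys n = []")
      case True
      then show ?thesis unfolding al sm y P_def[symmetric] using a IH' m by (cases P) simp_all
    next
      case False
      then show ?thesis unfolding al sm y P_def[symmetric] using a IH' m l by (cases P) (auto simp: successively_append_iff)
    qed
  qed
qed

text \<open>Integral partial sums in the unit interval are 0 or 1, and entries are differences of
  consecutive ones. Hence the bound on the entries need not appear on the right.\<close>

lemma alternating_iff:
  fixes f :: "nat \<Rightarrow> real"
  assumes "\<And>j. f j \<in> \<int>"
  shows "(\<forall>j\<in>{1..n}. f j \<in> {0, 1, -1}) \<and> alternating (map f [1..<Suc n]) \<longleftrightarrow>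
    (\<forall>m\<le>n. 0 \<le> sum f {1..m} \<and> sum f {1..m} \<le> 1) \<and> sum f {1..n} = 1"
proof -
  have r: "0 \<le> x \<and> x \<le> 1 \<longleftrightarrow> x \<in> {0, 1}" if "x \<in> \<int>" for x :: real
    using that by (auto elim!: Ints_cases)
  have sI: "sum f {1..m} \<in> \<int>" for m using assms by (simp add: Ints_sum)
  have "f j \<in> {0, 1, -1}" if p: "\<forall>m\<le>n. sum f {1..m} \<in> {0, 1}" and j: "j \<in> {1..n}" for j
  proof -
    obtain i where i: "j = Suc i" using j by (cases j) auto
    have "sum f {1..i} \<in> {0, 1}" "sum f {1..i} + f j \<in> {0, 1}"
      using p[rule_format, of i] p[rule_format, of j] j i by auto
    then show ?thesis by auto
  qed
  then show ?thesis
    unfolding r[OF sI] alternating_def Let_def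
    using alternating_prefix_sums[of n f] by blast
qed

section \<open>From the integer Caratheodory property to integer decomposition\<close>

lemma decomposition_if_caratheodory:
  fixes Q :: "('a \<Rightarrow> real) set"
  assumes "integer_caratheodory I Q"
  shows "integer_decomposition I Q"
  unfolding integer_decomposition_def
proof (intro allI impI ballI)
  fix r :: nat and x :: "'a \<Rightarrow> real"
  assume "r > 0" and x: "x \<in> (\<lambda>q. real r *\<^sub>R q) ` Q \<inter> int_lattice I"
  then obtain V c where V: "finite V" "V \<subseteq> Q \<inter> int_lattice I" "x = (\<Sum>v\<in>V. real (c v) *\<^sub>R v)"
      "(\<Sum>v\<in>V. c v) = r"
    using assms[unfolded integer_caratheodory_def, rule_format, OF \<open>r > 0\<close> x] by auto
  have "\<exists>v :: nat \<Rightarrow> 'a \<Rightarrow> real. (\<forall>k<sum c V. v k \<in> V) \<and> (\<Sum>v\<in>V. real (c v) *\<^sub>R v) = (\<Sum>k<sum c V. v k)"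
    using V(1)
  proof induction
    case (insert a V)
    then obtain v :: "nat \<Rightarrow> 'a \<Rightarrow> real" where v: "\<forall>k<sum c V. v k \<in> V" "(\<Sum>v\<in>V. real (c v) *\<^sub>R v) = (\<Sum>k<sum c V. v k)"
      by blast
    \<comment> \<open>The list for \<open>V\<close> is continued by copies of the new point
      \<open>a\<close>, of which the first \<open>c a\<close> are used.\<close>
    define w where "w k = (if k < sum c V then v k else a)" for k
    have "(\<Sum>k<sum c V + m. w k) = (\<Sum>k<sum c V. v k) + real m *\<^sub>R a" for m
      by (induction m) (simp_all add: w_def algebra_simps)
    with v insert.hyps show ?case
      by (intro exI[of _ w]) (auto simp: w_def add.commute)
  qed simp
  then show "\<exists>v. (\<forall>k<r. v k \<in> Q \<inter> int_lattice I) \<and> x = (\<Sum>k<r. v k)"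
    using V by blast
qed

section \<open>Generators of the symmetry classes\<close>

definition vsym :: "symmetry_class \<Rightarrow> bool" where "vsym X \<longleftrightarrow> X \<in> {VSASM, VHSASM, TSASM}"
definition hsym :: "symmetry_class \<Rightarrow> bool" where "hsym X \<longleftrightarrow> X \<in> {VHSASM, TSASM}"
definition tsym :: "symmetry_class \<Rightarrow> bool" where "tsym X \<longleftrightarrow> X \<in> {DSASM, DASASM, TSASM}"
definition rsym :: "symmetry_class \<Rightarrow> bool" where "rsym X \<longleftrightarrow> X \<in> {HTSASM, DASASM}"

lemmas sym_defs = vsym_def hsym_def tsym_def rsym_def

text \<open>Reduces seven classes to four kinds of invariance. For \<open>DASASM\<close>, the
  reflection in the antidiagonal composed with transposition is the half-turn; for
  \<open>TSASM\<close>, conjugating the column reflection by transposition gives the row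
  reflection.\<close>

lemma has_symmetry_iff:
  "has_symmetry X n x \<longleftrightarrow>
    (vsym X \<longrightarrow> (\<forall>i\<in>{1..n}. \<forall>j\<in>{1..n}. x (i, n + 1 - j) = x (i, j))) \<and>
    (hsym X \<longrightarrow> (\<forall>i\<in>{1..n}. \<forall>j\<in>{1..n}. x (n + 1 - i, j) = x (i, j))) \<and>
    (tsym X \<longrightarrow> (\<forall>i\<in>{1..n}. \<forall>j\<in>{1..n}. x (j, i) = x (i, j))) \<and>
    (rsym X \<longrightarrow> (\<forall>i\<in>{1..n}. \<forall>j\<in>{1..n}. x (n + 1 - i, n + 1 - j) = x (i, j)))"
proof -
  have refl: "n + 1 - i \<in> {1..n}" if "i \<in> {1..n}" for i using that by auto
  show ?thesis
  proof (cases X)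
    case DASASM
    have "has_symmetry DASASM n x \<longleftrightarrow>
      (\<forall>i\<in>{1..n}. \<forall>j\<in>{1..n}. x (j, i) = x (i, j)) \<and>
      (\<forall>i\<in>{1..n}. \<forall>j\<in>{1..n}. x (n + 1 - i, n + 1 - j) = x (i, j))"
      unfolding has_symmetry.simps using refl by metis
    then show ?thesis unfolding DASASM by (simp add: sym_defs)
  next
    case TSASM
    have "has_symmetry TSASM n x \<longleftrightarrow>
      (\<forall>i\<in>{1..n}. \<forall>j\<in>{1..n}. x (i, n + 1 - j) = x (i, j)) \<and>
      (\<forall>i\<in>{1..n}. \<forall>j\<in>{1..n}. x (n + 1 - i, j) = x (i, j)) \<and>
      (\<forall>i\<in>{1..n}. \<forall>j\<in>{1..n}. x (j, i) = x (i, j))"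
      unfolding has_symmetry.simps
    proof safe
      fix i j assume s: "\<forall>i\<in>{1..n}. \<forall>j\<in>{1..n}. x (i, j) = x (i, n + 1 - j) \<and> x (i, j) = x (j, i)"
        and ij: "i \<in> {1..n}" "j \<in> {1..n}"
      then show "x (n + 1 - i, j) = x (i, j)" using refl by metis
    qed metis+
    then show ?thesis unfolding TSASM by (simp add: sym_defs)
  next
    case VHSASM
    then show ?thesis by (simp add: sym_defs) metis
  next
    case HTSASM
    then show ?thesis by (simp add: sym_defs) metis
  next
    case DSASM
    then show ?thesis by (simp add: sym_defs) metis
  next
    case VSASM
    then show ?thesis by (simp add: sym_defs) metis
  next
    case ASM
    then show ?thesis by (simp add: sym_defs)
  qed
qed

section \<open>Corner sums and their inversion\<close>

definition corner :: "matr \<Rightarrow> nat \<Rightarrow> nat \<Rightarrow> real"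
  where "corner x i j = (\<Sum>a=1..i. \<Sum>b=1..j. x (a, b))"

text \<open>The mixed second difference, inverse to \<open>corner\<close>. Truncated subtraction is
  harmless since indices in \<open>square n\<close> start at 1.\<close>

definition entries :: "nat \<Rightarrow> (nat \<Rightarrow> nat \<Rightarrow> real) \<Rightarrow> matr"
  where "entries n c =
    restrict0 (square n) (\<lambda>(i, j). c i j - c (i - 1) j - c i (j - 1) + c (i - 1) (j - 1))"

lemma corner_0 [simp]: "corner x 0 j = 0" "corner x i 0 = 0"
  by (simp_all add: corner_def)

lemma corner_Suc_row: "corner x (Suc i) j = corner x i j + (\<Sum>b=1..j. x (Suc i, b))"
  by (simp add: corner_def)

lemma corner_Suc_col: "corner x i (Suc j) = corner x i j + (\<Sum>a=1..i. x (a, Suc j))"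
  by (simp add: corner_def sum.distrib)

lemma corner_swap: "corner (x \<circ> prod.swap) i j = corner x j i"
  unfolding corner_def by (subst sum.swap) simp

lemma corner_add: "corner (x + y) i j = corner x i j + corner y i j"
  by (simp add: corner_def sum.distrib)

lemma corner_scaleR: "corner (u *\<^sub>R x) i j = u * corner x i j"
  by (simp add: corner_def scaleR_fun_def sum_distrib_left)

lemma int_lattice_Ints: "x \<in> int_lattice I \<Longrightarrow> x p \<in> \<int>"
  by (cases "p \<in> I") (auto simp: int_lattice_def)

lemma corner_Ints: "x \<in> int_lattice (square n) \<Longrightarrow> corner x i j \<in> \<int>"
  unfolding corner_def using int_lattice_Ints by (intro Ints_sum)

lemma entries_corner:
  assumes "\<And>p. p \<notin> square n \<Longrightarrow> x p = 0"
  shows "entries n (corner x) = x"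
proof
  fix p :: "nat \<times> nat"
  obtain i j where p: "p = (i, j)" by force
  show "entries n (corner x) p = x p"
  proof (cases "p \<in> square n")
    case True
    then obtain k l where "i = Suc k" "j = Suc l"
      by (cases i; cases j) (auto simp: p square_def)
    then show ?thesis using True
      by (simp add: entries_def restrict0_def p corner_Suc_row)
  qed (use assms in \<open>simp add: entries_def restrict0_def\<close>)
qed

lemma corner_entries:
  assumes "\<And>i. i \<le> n \<Longrightarrow> c i 0 = 0" "\<And>i. i \<le> n \<Longrightarrow> c 0 i = 0" "i \<le> n" "j \<le> n"
  shows "corner (entries n c) i j = c i j"
  using assms(3)
proof (induction i)
  case 0
  then show ?case using assms by simp
next
  case (Suc i)
  have "(\<Sum>b=1..j. entries n c (Suc i, b)) = c (Suc i) j - c i j"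
    using assms(4)
  proof (induction j)
    case 0
    then show ?case using assms(1)[of i] assms(1)[of "Suc i"] Suc.prems by simp
  next
    case (Suc j)
    then show ?case using \<open>Suc i \<le> n\<close> by (simp add: entries_def restrict0_def square_def)
  qed
  then show ?case using Suc by (simp add: corner_Suc_row)
qed

text \<open>The first \<open>n - j\<close> columns of \<open>y\<close> are the last
  \<open>n - j\<close> columns of \<open>x\<close>, whose sum is the total minus the first
  \<open>j\<close>. Two matrices are allowed so that reflections can be composed to a
  half-turn.\<close>

lemma corner_reflect_cols:
  assumes "\<And>a b. a \<in> {1..n} \<Longrightarrow> b \<in> {1..n} \<Longrightarrow> y (a, b) = x (a, n + 1 - b)"
    and "i \<le> n" "j \<le> n"
  shows "corner y i (n - j) = corner x i n - corner x i j"
proof -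
  have "(\<Sum>b=1..n-j. y (a, b)) = (\<Sum>b=1..n. x (a, b)) - (\<Sum>b=1..j. x (a, b))" if "a \<in> {1..i}" for a
  proof -
    have "(\<Sum>b=1..n-j. y (a, b)) = (\<Sum>b=j+1..n. x (a, b))"
      by (rule sum.reindex_bij_witness[of _ "\<lambda>b. n + 1 - b" "\<lambda>b. n + 1 - b"])
         (use assms that in auto)
    moreover have "(\<Sum>b=1..n. x (a, b)) = (\<Sum>b=1..j. x (a, b)) + (\<Sum>b=j+1..n. x (a, b))"
      using sum.ub_add_nat[of 1 j "\<lambda>b. x (a, b)" "n - j"] assms(3) by simp
    ultimately show ?thesis by simp
  qed
  then show ?thesis by (simp add: corner_def sum_subtractf)
qed

lemma corner_reflect_rows:
  assumes "\<And>a b. a \<in> {1..n} \<Longrightarrow> b \<in> {1..n} \<Longrightarrow> y (a, b) = x (n + 1 - a, b)"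
    and "i \<le> n" "j \<le> n"
  shows "corner y (n - i) j = corner x n j - corner x i j"
  using corner_reflect_cols[of n "y \<circ> prod.swap" "x \<circ> prod.swap" j i] assms
  by (simp add: corner_swap)

text \<open>The system for \<open>r\<close> times a point of the polytope.  With a reflection symmetry the
  integer points satisfy \<open>2 c\<^sub>i\<^sub>k \<in> {i - 1, i}\<close> next to the axis, where \<open>k = \<lfloor>n / 2\<rfloor>\<close>;
  this forces the value \<open>\<lfloor>i / 2\<rfloor>\<close> there.\<close>

definition height :: "symmetry_class \<Rightarrow> nat \<Rightarrow> real \<Rightarrow> (nat \<Rightarrow> nat \<Rightarrow> real) \<Rightarrow> bool"
  where "height X n r c \<longleftrightarrow>
    (\<forall>i\<le>n. c i 0 = 0 \<and> c 0 i = 0 \<and> c i n = r * real i \<and> c n i = r * real i) \<and>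
    (\<forall>i<n. \<forall>j\<le>n. c i j \<le> c (Suc i) j \<and> c (Suc i) j \<le> c i j + r) \<and>
    (\<forall>i\<le>n. \<forall>j<n. c i j \<le> c i (Suc j) \<and> c i (Suc j) \<le> c i j + r) \<and>
    (vsym X \<longrightarrow> odd n \<and> (\<forall>i\<le>n. c i (n div 2) = r * real (i div 2)) \<and>
      (\<forall>i\<le>n. \<forall>j\<le>n. c i (n - j) = r * real i - c i j)) \<and>
    (hsym X \<longrightarrow> odd n \<and> (\<forall>j\<le>n. c (n div 2) j = r * real (j div 2)) \<and>
      (\<forall>i\<le>n. \<forall>j\<le>n. c (n - i) j = r * real j - c i j)) \<and>
    (tsym X \<longrightarrow> (\<forall>i\<le>n. \<forall>j\<le>n. c j i = c i j)) \<and>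
    (rsym X \<longrightarrow> (\<forall>i\<le>n. \<forall>j\<le>n. c (n - i) (n - j) = c i j + r * (real n - real i - real j)))"

lemma heightD:
  assumes "height X n r c"
  shows "i \<le> n \<Longrightarrow> c i 0 = 0" "i \<le> n \<Longrightarrow> c 0 i = 0"
    "i \<le> n \<Longrightarrow> c i n = r * real i" "i \<le> n \<Longrightarrow> c n i = r * real i"
    "i < n \<Longrightarrow> j \<le> n \<Longrightarrow> c i j \<le> c (Suc i) j \<and> c (Suc i) j \<le> c i j + r"
    "i \<le> n \<Longrightarrow> j < n \<Longrightarrow> c i j \<le> c i (Suc j) \<and> c i (Suc j) \<le> c i j + r"
    "vsym X \<Longrightarrow> odd n" "hsym X \<Longrightarrow> odd n"
    "vsym X \<Longrightarrow> i \<le> n \<Longrightarrow> c i (n div 2) = r * real (i div 2)"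
    "hsym X \<Longrightarrow> i \<le> n \<Longrightarrow> c (n div 2) i = r * real (i div 2)"
    "vsym X \<Longrightarrow> i \<le> n \<Longrightarrow> j \<le> n \<Longrightarrow> c i (n - j) = r * real i - c i j"
    "hsym X \<Longrightarrow> i \<le> n \<Longrightarrow> j \<le> n \<Longrightarrow> c (n - i) j = r * real j - c i j"
    "tsym X \<Longrightarrow> i \<le> n \<Longrightarrow> j \<le> n \<Longrightarrow> c j i = c i j"
    "rsym X \<Longrightarrow> i \<le> n \<Longrightarrow> j \<le> n \<Longrightarrow>
      c (n - i) (n - j) = c i j + r * (real n - real i - real j)"
  using assms unfolding height_def by simp_all

section \<open>Symmetric alternating sign matrices as integer height functions\<close>

text \<open>For even \<open>n\<close> the axis is its own mirror image, so
  \<open>2 * c 1 (n div 2) = 1\<close>, contradicting integrality. For odd \<open>n\<close> the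
  mirror image of line \<open>n div 2\<close> is the next line, and the step bounds squeeze
  \<open>i\<close> between \<open>2 * c i (n div 2)\<close> and that plus 1.\<close>

lemma reflected_middle:
  fixes c :: "nat \<Rightarrow> nat \<Rightarrow> real"
  assumes "n > 0" "\<And>i j. i \<le> n \<Longrightarrow> j \<le> n \<Longrightarrow> c i (n - j) = real i - c i j"
    and "\<And>i j. i \<le> n \<Longrightarrow> j < n \<Longrightarrow> c i j \<le> c i (Suc j) \<and> c i (Suc j) \<le> c i j + 1"
    and "\<And>i j. c i j \<in> \<int>"
  shows "odd n \<and> (\<forall>i\<le>n. c i (n div 2) = real (i div 2))"
proof -
  have odd: "odd n"
  proof
    assume "even n"
    then have "n - n div 2 = n div 2" by auto
    then have e: "2 * c 1 (n div 2) = 1" using assms(2)[of 1 "n div 2"] assms(1) by simp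
    obtain m where "c 1 (n div 2) = of_int m" using assms(4) Ints_cases by blast
    then have "of_int (2 * m) = (of_int 1 :: real)" using e by simp
    then have "2 * m = 1" by (simp only: of_int_eq_iff)
    then show False by presburger
  qed
  have "c i (n div 2) = real (i div 2)" if i: "i \<le> n" for i
  proof -
    have "n - n div 2 = Suc (n div 2)" using odd by presburger
    then have e: "c i (Suc (n div 2)) = real i - c i (n div 2)" using assms(2)[OF i, of "n div 2"] by simp
    obtain m where m: "c i (n div 2) = of_int m" using assms(4) Ints_cases by blast
    have "c i (n div 2) \<le> c i (Suc (n div 2)) \<and> c i (Suc (n div 2)) \<le> c i (n div 2) + 1"
      using assms(3)[OF i, of "n div 2"] assms(1) by auto
    then have "2 * m \<le> int i" "int i \<le> 2 * m + 1" using e m by linarith+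
    then have "m = int (i div 2)" by presburger
    then show ?thesis using m by simp
  qed
  then show ?thesis using odd by blast
qed

text \<open>Applying \<open>alternating_iff\<close> to all rows and columns leaves integrality plus
  linear conditions; these are bounds on the increments of corner sums.\<close>

lemma is_ASM_iff:
  "is_ASM n x \<longleftrightarrow> x \<in> int_lattice (square n) \<and>
    (\<forall>i\<in>{1..n}. (\<forall>m\<le>n. 0 \<le> (\<Sum>j=1..m. x (i, j)) \<and> (\<Sum>j=1..m. x (i, j)) \<le> 1) \<and>
       (\<Sum>j=1..n. x (i, j)) = 1) \<and>
    (\<forall>j\<in>{1..n}. (\<forall>m\<le>n. 0 \<le> (\<Sum>i=1..m. x (i, j)) \<and> (\<Sum>i=1..m. x (i, j)) \<le> 1) \<and>
       (\<Sum>i=1..n. x (i, j)) = 1)"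
proof (cases "x \<in> int_lattice (square n)")
  case True
  then have I: "x p \<in> \<int>" for p by (rule int_lattice_Ints)
  have A: "is_ASM n x \<longleftrightarrow>
    (\<forall>i\<in>{1..n}. (\<forall>j\<in>{1..n}. x (i, j) \<in> {0, 1, -1}) \<and> alternating (map (\<lambda>j. x (i, j)) [1..<Suc n])) \<and>
    (\<forall>j\<in>{1..n}. (\<forall>i\<in>{1..n}. x (i, j) \<in> {0, 1, -1}) \<and> alternating (map (\<lambda>i. x (i, j)) [1..<Suc n]))"
    using True unfolding is_ASM_def int_lattice_def square_def by blast
  show ?thesis
    unfolding A alternating_iff[of "\<lambda>j. x (_, j)" n, OF I] alternating_iff[of "\<lambda>i. x (i, _)" n, OF I]
    using True by (simp only: simp_thms)
next
  case False
  then show ?thesis by (auto simp: is_ASM_def int_lattice_def)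
qed

lemma height_if_XASM:
  assumes "n > 0" "x \<in> XASMs X n"
  shows "height X n 1 (corner x)"
proof -
  have x: "is_ASM n x" "has_symmetry X n x" using assms by (auto simp: XASMs_def)
  note A = x(1)[unfolded is_ASM_iff]
  have row: "0 \<le> (\<Sum>b=1..j. x (Suc i, b))" "(\<Sum>b=1..j. x (Suc i, b)) \<le> 1" if "i < n" "j \<le> n" for i j
    using A that by auto
  have col: "0 \<le> (\<Sum>a=1..i. x (a, Suc j))" "(\<Sum>a=1..i. x (a, Suc j)) \<le> 1" if "j < n" "i \<le> n" for i j
    using A that by auto
  have Ir: "corner x i j \<le> corner x (Suc i) j \<and> corner x (Suc i) j \<le> corner x i j + 1" if "i < n" "j \<le> n" for i j
    using row[OF that] unfolding corner_Suc_row by linarith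
  have Ic: "corner x i j \<le> corner x i (Suc j) \<and> corner x i (Suc j) \<le> corner x i j + 1" if "j < n" "i \<le> n" for i j
    using col[OF that] unfolding corner_Suc_col by linarith
  have tr: "corner x i n = real i" if "i \<le> n" for i
    using that
  proof (induction i)
    case (Suc i)
    have "Suc i \<in> {1..n}" using Suc.prems by simp
    then show ?case using Suc A unfolding corner_Suc_row by force
  qed simp
  have tc: "corner x n i = real i" if "i \<le> n" for i
    using that
  proof (induction i)
    case (Suc i)
    have "Suc i \<in> {1..n}" using Suc.prems by simp
    then show ?case using Suc A unfolding corner_Suc_col by force
  qed simp
  note S = x(2)[unfolded has_symmetry_iff]
  have Z: "corner x i j \<in> \<int>" for i j using A corner_Ints by blast
  have V: "corner x i (n - j) = real i - corner x i j" if "vsym X" "i \<le> n" "j \<le> n" for i j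
    using corner_reflect_cols[of n x x i j] S that tr by simp
  have H: "corner x (n - i) j = real j - corner x i j" if "hsym X" "i \<le> n" "j \<le> n" for i j
    using corner_reflect_rows[of n x x i j] S that tc by simp
  have Vm: "vsym X \<Longrightarrow> odd n \<and> (\<forall>i\<le>n. corner x i (n div 2) = real (i div 2))"
    using reflected_middle[of n "corner x"] assms(1) V Ic Z by blast
  have Hm: "hsym X \<Longrightarrow> odd n \<and> (\<forall>i\<le>n. corner x (n div 2) i = real (i div 2))"
    using reflected_middle[of n "\<lambda>i j. corner x j i"] assms(1) H Ir Z by blast
  have T: "corner x j i = corner x i j" if "tsym X" "i \<le> n" "j \<le> n" for i j
  proof -
    have "corner x i j = (\<Sum>a=1..i. \<Sum>b=1..j. (x \<circ> prod.swap) (a, b))"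
      unfolding corner_def by (intro sum.cong) (use S that in auto)
    then have "corner x i j = corner (x \<circ> prod.swap) i j" by (simp add: corner_def)
    then show ?thesis by (simp add: corner_swap)
  qed
  have R: "corner x (n - i) (n - j) = corner x i j + (real n - real i - real j)"
    if "rsym X" "i \<le> n" "j \<le> n" for i j
  proof -
    \<comment> \<open>The half-turn is a column reflection followed by a row reflection;
      \<open>y\<close> is the matrix in between.\<close>
    define y where "y = (\<lambda>(a, b). x (a, n + 1 - b))"
    have "corner y i (n - j) = real i - corner x i j"
      using corner_reflect_cols[of n y x i j] that tr by (simp add: y_def)
    moreover have "corner y n (n - j) = real (n - j)"
      using corner_reflect_cols[of n y x n j] that tr[of n] tc[of j] by (simp add: y_def)
    moreover have "x (a, b) = y (n + 1 - a, b)" if "a \<in> {1..n}" "b \<in> {1..n}" for a b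
      using S \<open>rsym X\<close> that unfolding y_def by simp
    then have "corner x (n - i) (n - j) = corner y n (n - j) - corner y i (n - j)"
      by (intro corner_reflect_rows) (use that in auto)
    ultimately show ?thesis using that by simp
  qed
  show ?thesis
    unfolding height_def
    using tr tc Ir Ic V H Vm Hm T R by simp
qed

text \<open>Partial row and column sums of \<open>entries n c\<close> telescope to increments of
  \<open>c\<close>, which the height system bounds. Each symmetry of \<open>c\<close> passes to its
  mixed differences, where the added terms cancel.\<close>

lemma XASM_if_height:
  assumes "height X n 1 c" "\<And>i j. c i j \<in> \<int>"
  shows "entries n c \<in> XASMs X n"
proof -
  note h = heightD[OF assms(1)]
  define x where "x = entries n c"
  have cx: "corner x i j = c i j" if "i \<le> n" "j \<le> n" for i j
    unfolding x_def by (rule corner_entries) (use h(1,2) that in auto)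
  have xe: "x (i, j) = c i j - c (i - 1) j - c i (j - 1) + c (i - 1) (j - 1)"
    if "i \<in> {1..n}" "j \<in> {1..n}" for i j
    using that by (simp add: x_def entries_def restrict0_def square_def)
  have lat: "x \<in> int_lattice (square n)"
    using assms(2) by (auto simp: x_def entries_def restrict0_def int_lattice_def)
  have row: "(\<Sum>b=1..j. x (i, b)) = c i j - c (i - 1) j" if "i \<in> {1..n}" "j \<le> n" for i j
    using corner_Suc_row[of x "i - 1" j] that by (auto simp: cx)
  have col: "(\<Sum>a=1..i. x (a, j)) = c i j - c i (j - 1)" if "j \<in> {1..n}" "i \<le> n" for i j
    using corner_Suc_col[of x i "j - 1"] that by (auto simp: cx)
  have "is_ASM n x"
    unfolding is_ASM_iff
  proof (intro conjI ballI allI impI lat)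
    fix i m assume i: "i \<in> {1..n}" and m: "m \<le> n"
    have d: "c (i - 1) m \<le> c i m \<and> c i m \<le> c (i - 1) m + 1" "c m (i - 1) \<le> c m i \<and> c m i \<le> c m (i - 1) + 1"
      using h(5)[of "i - 1" m] h(6)[of m "i - 1"] i m by auto
    show "0 \<le> (\<Sum>j=1..m. x (i, j))" "(\<Sum>j=1..m. x (i, j)) \<le> 1"
      "0 \<le> (\<Sum>j=1..m. x (j, i))" "(\<Sum>j=1..m. x (j, i)) \<le> 1"
      using d row[OF i m] col[OF i m] by auto
  next
    fix i assume i: "i \<in> {1..n}"
    then have "c i n = real i" "c (i - 1) n = real i - 1" "c n i = real i" "c n (i - 1) = real i - 1"
      using h(3)[of i] h(3)[of "i - 1"] h(4)[of i] h(4)[of "i - 1"] by auto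
    then show "(\<Sum>j=1..n. x (i, j)) = 1" "(\<Sum>j=1..n. x (j, i)) = 1"
      using row[OF i, of n] col[OF i, of n] by auto
  qed
  moreover have "has_symmetry X n x"
    unfolding has_symmetry_iff
  proof (intro conjI ballI impI)
    fix i j assume i: "i \<in> {1..n}" and j: "j \<in> {1..n}"
    \<comment> \<open>Entry index \<open>n + 1 - i\<close> corresponds to the corner indices
      \<open>n - (i - 1)\<close> and \<open>n - i\<close>: reflection swaps the two ends of the
      difference, which cancels the minus sign in front of \<open>c\<close>.\<close>
    have m: "n + 1 - i = n - (i - 1)" "n + 1 - i - 1 = n - i" "n + 1 - j = n - (j - 1)" "n + 1 - j - 1 = n - j"
      "n + 1 - i \<in> {1..n}" "n + 1 - j \<in> {1..n}" "i - 1 \<le> n" "j - 1 \<le> n" "i \<le> n" "j \<le> n"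
      using i j by auto
    have r: "real (i - 1) = real i - 1" "real (j - 1) = real j - 1" using i j by auto
    show "x (i, n + 1 - j) = x (i, j)" if "vsym X"
    proof -
      have "c a (n - b) = real a - c a b" if "a \<le> n" "b \<le> n" for a b
        using h(11)[OF \<open>vsym X\<close>] that by simp
      from this[of _ j] this[of _ "j - 1", folded m(3)] show ?thesis
        using xe[OF i j] xe[OF i m(6)] m(7-10) r unfolding m(4) by simp
    qed
    show "x (n + 1 - i, j) = x (i, j)" if "hsym X"
    proof -
      have "c (n - a) b = real b - c a b" if "a \<le> n" "b \<le> n" for a b
        using h(12)[OF \<open>hsym X\<close>] that by simp
      from this[of i] this[of "i - 1", folded m(1)] show ?thesis
        using xe[OF i j] xe[OF m(5) j] m(7-10) r unfolding m(2) by simp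
    qed
    show "x (j, i) = x (i, j)" if "tsym X"
    proof -
      have "c b a = c a b" if "a \<le> n" "b \<le> n" for a b
        using h(13)[OF \<open>tsym X\<close>] that by simp
      then show ?thesis unfolding xe[OF i j] xe[OF j i] using m(7-10) by simp
    qed
    show "x (n + 1 - i, n + 1 - j) = x (i, j)" if "rsym X"
    proof -
      have "c (n - a) (n - b) = c a b + (real n - real a - real b)" if "a \<le> n" "b \<le> n" for a b
        using h(14)[OF \<open>rsym X\<close>] that by simp
      from this[of i j] this[of i "j - 1", folded m(3)] this[of "i - 1" j, folded m(1)]
        this[of "i - 1" "j - 1", folded m(1,3)]
      show ?thesis using xe[OF i j] xe[OF m(5) m(6)] m(7-10) r unfolding m(2,4) by simp
    qed
  qed
  ultimately show ?thesis by (simp add: XASMs_def x_def)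
qed

section \<open>The height system on the convex hull\<close>

text \<open>The weights are arbitrary nonnegative numbers, so that the lemma covers convex
  combinations as well as dilation by \<open>r\<close>.\<close>

lemma height_lincomb:
  assumes "height X n r c" "height X n s d" "u \<ge> 0" "v \<ge> 0"
  shows "height X n (u * r + v * s) (\<lambda>i j. u * c i j + v * d i j)"
proof -
  note h = heightD[OF assms(1)] heightD[OF assms(2)]
  have m: "u * a + v * b \<le> u * a' + v * b' \<and> u * a' + v * b' \<le> u * a + v * b + (u * r + v * s)"
    if "a \<le> a' \<and> a' \<le> a + r" "b \<le> b' \<and> b' \<le> b + s" for a a' b b'
    using that assms(3,4) mult_left_mono[of a a' u] mult_left_mono[of b b' v]
      mult_left_mono[of a' "a + r" u] mult_left_mono[of b' "b + s" v]
    by (simp add: algebra_simps)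
  show ?thesis
    unfolding height_def
  proof (intro conjI impI; (intro allI impI)?)
    fix i j assume "i < n" "j \<le> n"
    then show "u * c i j + v * d i j \<le> u * c (Suc i) j + v * d (Suc i) j \<and>
      u * c (Suc i) j + v * d (Suc i) j \<le> u * c i j + v * d i j + (u * r + v * s)"
      by (intro m) (use h in simp_all)
  next
    fix i j assume "i \<le> n" "j < n"
    then show "u * c i j + v * d i j \<le> u * c i (Suc j) + v * d i (Suc j) \<and>
      u * c i (Suc j) + v * d i (Suc j) \<le> u * c i j + v * d i j + (u * r + v * s)"
      by (intro m) (use h in simp_all)
  qed (simp_all add: h(1-4,7-14) h(15-18,21-28) algebra_simps)
qed

text \<open>The conditions define a convex set of matrices containing all generators of the
  hull.\<close>

lemma P_full_height:
  assumes "n > 0" "q \<in> P_full X n"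
  shows "height X n 1 (corner q)" "p \<notin> square n \<Longrightarrow> q p = 0"
proof -
  have "convex {q. height X n 1 (corner q) \<and> (\<forall>p. p \<notin> square n \<longrightarrow> q p = 0)}" (is "convex ?S")
    unfolding convex_def
  proof (intro ballI allI impI)
    fix x y and u v :: real assume "x \<in> ?S" "y \<in> ?S" "0 \<le> u" "0 \<le> v" "u + v = 1"
    then have "height X n (u * 1 + v * 1) (\<lambda>i j. u * corner x i j + v * corner y i j)"
      by (intro height_lincomb) auto
    moreover have "corner (u *\<^sub>R x + v *\<^sub>R y) = (\<lambda>i j. u * corner x i j + v * corner y i j)"
      by (intro ext) (simp add: corner_add corner_scaleR)
    ultimately have "height X n 1 (corner (u *\<^sub>R x + v *\<^sub>R y))"
      using \<open>u + v = 1\<close> by simp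
    then show "u *\<^sub>R x + v *\<^sub>R y \<in> ?S"
      using \<open>x \<in> ?S\<close> \<open>y \<in> ?S\<close> by (simp add: scaleR_fun_def)
  qed
  moreover have "XASMs X n \<subseteq> ?S"
    using height_if_XASM[OF assms(1)] by (auto simp: XASMs_def is_ASM_def)
  ultimately have "q \<in> ?S"
    using assms(2) hull_minimal[of "XASMs X n" ?S convex] by (auto simp: P_full_def)
  then show "height X n 1 (corner q)" "p \<notin> square n \<Longrightarrow> q p = 0"
    unfolding mem_Collect_eq by blast+
qed

section \<open>Rounding that respects the symmetries\<close>

text \<open>On corner indices the reflection is \<open>j\<close> to \<open>n - j\<close>, so for odd
  \<open>n\<close> the axis runs between \<open>n div 2\<close> and its successor. Crossing both
  axes restores the sign.\<close>

definition half_sign :: "symmetry_class \<Rightarrow> nat \<Rightarrow> nat \<Rightarrow> nat \<Rightarrow> real"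
  where "half_sign X n i j =
    (if vsym X \<and> n < 2 * j then -1 else 1) * (if hsym X \<and> n < 2 * i then -1 else 1)"

lemma half_sign_pm: "half_sign X n i j \<in> {1, -1}"
  by (simp add: half_sign_def)

text \<open>A reflection turns \<open>c\<close> into a constant minus \<open>c\<close>, so floors on one side of
  the axis must become ceilings on the other; the forced middle lines glue the two sides.\<close>

lemma height_rnd:
  assumes "height X n (real r) c" "t < r"
  shows "height X n 1 (\<lambda>i j. rnd r (half_sign X n i j) t (c i j))"
proof -
  note h = heightD[OF assms(1)]
  have r: "r > 0" using assms(2) by simp
  have nat: "rnd r (half_sign X n i j) t (real r * real m) = real m" for i j m
    using rnd_mult[OF assms(2) half_sign_pm, of X n i j "int m"] by simp
  have step: "rnd r s t a \<le> rnd r s t b \<and> rnd r s t b \<le> rnd r s t a + 1"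
    if "a \<le> b \<and> b \<le> a + real r" "s \<in> {1, -1}" for a b s
    using rnd_mono[of a b s r t] rnd_mono[of b "a + real r" s r t] rnd_shift[OF r, of s t a 1] that
    by simp
  have mid: "n - n div 2 = Suc (n div 2)" if "odd n" using that by presburger
  have nat0: "rnd r (half_sign X n i j) t 0 = 0" for i j using nat[of i j 0] by simp
  show ?thesis
    unfolding height_def
  proof (intro conjI impI; (intro allI impI)?)
    fix i assume "i \<le> n"
    then show "rnd r (half_sign X n i 0) t (c i 0) = 0 \<and> rnd r (half_sign X n 0 i) t (c 0 i) = 0 \<and>
      rnd r (half_sign X n i n) t (c i n) = 1 * real i \<and> rnd r (half_sign X n n i) t (c n i) = 1 * real i"
      by (simp add: h(1-4) nat nat0)
  next
    fix i j assume ij: "i < n" "j \<le> n"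
    show "rnd r (half_sign X n i j) t (c i j) \<le> rnd r (half_sign X n (Suc i) j) t (c (Suc i) j) \<and>
      rnd r (half_sign X n (Suc i) j) t (c (Suc i) j) \<le> rnd r (half_sign X n i j) t (c i j) + 1"
    proof (cases "half_sign X n (Suc i) j = half_sign X n i j")
      case True
      then show ?thesis using step[OF h(5)[OF ij] half_sign_pm] by simp
    next
      case False
      \<comment> \<open>The sign changes only between line \<open>n div 2\<close> and the next one.
        Both carry multiples of \<open>r\<close>, the second by reflection of the first, and on
        these \<open>rnd\<close> is exact for either sign; a floor never has to be compared with a
        ceiling.\<close>
      then have H: "hsym X" and "\<not> n < 2 * i" "n < 2 * Suc i" by (auto simp: half_sign_def split: if_splits)
      then have i: "i = n div 2" by presburger
      have c: "c i j = real r * real (j div 2)" using h(10)[OF H ij(2)] i by simp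
      define e where "e = j - j div 2"
      have "c (Suc i) j = real r * real e"
        using h(12)[OF H _ ij(2), of i] ij c mid[OF h(8)[OF H]] i by (simp add: e_def of_nat_diff algebra_simps)
      moreover have "j div 2 \<le> e" "e \<le> j div 2 + 1" unfolding e_def by presburger+
      ultimately show ?thesis using c by (simp add: nat)
    qed
  next
    fix i j assume ij: "i \<le> n" "j < n"
    show "rnd r (half_sign X n i j) t (c i j) \<le> rnd r (half_sign X n i (Suc j)) t (c i (Suc j)) \<and>
      rnd r (half_sign X n i (Suc j)) t (c i (Suc j)) \<le> rnd r (half_sign X n i j) t (c i j) + 1"
    proof (cases "half_sign X n i (Suc j) = half_sign X n i j")
      case True
      then show ?thesis using step[OF h(6)[OF ij] half_sign_pm] by simp
    next
      case False
      then have V: "vsym X" and "\<not> n < 2 * j" "n < 2 * Suc j" by (auto simp: half_sign_def split: if_splits)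
      then have j: "j = n div 2" by presburger
      have c: "c i j = real r * real (i div 2)" using h(9)[OF V ij(1)] j by simp
      define e where "e = i - i div 2"
      have "c i (Suc j) = real r * real e"
        using h(11)[OF V ij(1), of j] ij c mid[OF h(7)[OF V]] j by (simp add: e_def of_nat_diff algebra_simps)
      moreover have "i div 2 \<le> e" "e \<le> i div 2 + 1" unfolding e_def by presburger+
      ultimately show ?thesis using c by (simp add: nat)
    qed
  next
    assume "vsym X" then show "odd n" by (rule h)
  next
    assume "hsym X" then show "odd n" by (rule h)
  next
    fix i assume "vsym X" "i \<le> n"
    then show "rnd r (half_sign X n i (n div 2)) t (c i (n div 2)) = 1 * real (i div 2)"
      by (simp add: h(9) nat)
  next
    fix i assume "hsym X" "i \<le> n"
    then show "rnd r (half_sign X n (n div 2) i) t (c (n div 2) i) = 1 * real (i div 2)"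
      by (simp add: h(10) nat)
  next
    fix i j assume a: "vsym X" "i \<le> n" "j \<le> n"
    \<comment> \<open>As \<open>n\<close> is odd, exactly one of \<open>j\<close> and
      \<open>n - j\<close> lies beyond the axis. The sign therefore flips together with
      \<open>c\<close>, as \<open>rnd_uminus\<close> requires.\<close>
    have "(n < 2 * (n - j)) = (\<not> n < 2 * j)" using h(7)[OF a(1)] a(3) by presburger
    then have s: "half_sign X n i (n - j) = - half_sign X n i j" using a by (simp add: half_sign_def)
    show "rnd r (half_sign X n i (n - j)) t (c i (n - j)) = 1 * real i - rnd r (half_sign X n i j) t (c i j)"
      using rnd_shift[OF r, of "- half_sign X n i j" t "- c i j" "int i"] half_sign_pm[of X n i j]
      by (auto simp: s h(11)[OF a] rnd_uminus)
  next
    fix i j assume a: "hsym X" "i \<le> n" "j \<le> n"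
    have "(n < 2 * (n - i)) = (\<not> n < 2 * i)" using h(8)[OF a(1)] a(2) by presburger
    then have s: "half_sign X n (n - i) j = - half_sign X n i j" using a by (simp add: half_sign_def)
    show "rnd r (half_sign X n (n - i) j) t (c (n - i) j) = 1 * real j - rnd r (half_sign X n i j) t (c i j)"
      using rnd_shift[OF r, of "- half_sign X n i j" t "- c i j" "int j"] half_sign_pm[of X n i j]
      by (auto simp: s h(12)[OF a] rnd_uminus)
  next
    fix i j assume a: "tsym X" "i \<le> n" "j \<le> n"
    then have "half_sign X n j i = half_sign X n i j" by (auto simp: half_sign_def sym_defs)
    then show "rnd r (half_sign X n j i) t (c j i) = rnd r (half_sign X n i j) t (c i j)"
      using h(13)[OF a] by simp
  next
    fix i j assume a: "rsym X" "i \<le> n" "j \<le> n"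
    then have s: "half_sign X n (n - i) (n - j) = half_sign X n i j" by (auto simp: half_sign_def sym_defs)
    show "rnd r (half_sign X n (n - i) (n - j)) t (c (n - i) (n - j)) =
      rnd r (half_sign X n i j) t (c i j) + 1 * (real n - real i - real j)"
      using rnd_shift[OF r half_sign_pm, of X n i j t "c i j" "int n - int i - int j"]
      by (simp add: s h(14)[OF a])
  qed
qed

section \<open>Decomposing integer points of the full polytope\<close>

lemma sum_fun_apply: "(\<Sum>k\<in>A. f k) p = (\<Sum>k\<in>A. f k p)"
  for f :: "'k \<Rightarrow> 'p \<Rightarrow> 'b::comm_monoid_add"
  by (induction A rule: infinite_finite_induct) simp_all

lemma XASM_decomposition:
  assumes "n > 0" "r > 0" "q \<in> P_full X n" "real r *\<^sub>R q \<in> int_lattice (square n)"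
  obtains v where "\<And>t. t < r \<Longrightarrow> v t \<in> XASMs X n" "(\<Sum>t<r. v t) = real r *\<^sub>R q"
    "\<not> affine_dependent (v ` {..<r})"
proof
  define y where "y = real r *\<^sub>R q"
  define c where "c = (\<lambda>t i j. rnd r (half_sign X n i j) t (corner y i j))"
  define v where "v = (\<lambda>t. entries n (c t))"
  \<comment> \<open>The summand of weight 0 turns \<open>height_lincomb\<close> into a
    dilation.\<close>
  have "height X n (real r * 1 + 0 * 1) (\<lambda>i j. real r * corner q i j + 0 * corner q i j)"
    by (intro height_lincomb P_full_height[OF assms(1,3)]) auto
  moreover have "corner y = (\<lambda>i j. real r * corner q i j)"
    by (intro ext) (simp add: y_def corner_scaleR)
  ultimately have hy: "height X n (real r) (corner y)" by simp
  have h: "height X n 1 (c t)" if "t < r" for t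
    unfolding c_def by (rule height_rnd[OF hy that])
  show "v t \<in> XASMs X n" if "t < r" for t
    unfolding v_def using h[OF that] by (rule XASM_if_height) (unfold c_def, rule rnd_Ints[OF half_sign_pm])
  have cs: "(\<Sum>t<r. c t i j) = corner y i j" for i j
    unfolding c_def by (intro sum_rnd assms(2) half_sign_pm corner_Ints) (use assms(4) y_def in auto)
  have "(\<Sum>t<r. v t) = entries n (corner y)"
    by (rule ext)
      (simp add: sum_fun_apply v_def entries_def restrict0_def sum.distrib sum_subtractf cs split: prod.split)
  also have "\<dots> = y"
    using P_full_height(2)[OF assms(1,3)] by (intro entries_corner) (simp add: y_def scaleR_fun_def)
  finally show "(\<Sum>t<r. v t) = real r *\<^sub>R q" by (simp add: y_def)
  have cv: "corner (v t) i j = c t i j" if "t < r" "i \<le> n" "j \<le> n" for t i j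
    unfolding v_def by (rule corner_entries) (use heightD(1,2)[OF h] that in auto)
  \<comment> \<open>Corner sums are the separating functionals. Indices are cut off at
    \<open>n\<close> because \<open>cv\<close> identifies the corner sums of \<open>v t\<close> only
    up to there.\<close>
  define L where "L = (\<lambda>(i, j) x. corner x (min i n) (min j n))"
  show "\<not> affine_dependent (v ` {..<r})"
  proof (rule chain_affine_independent[of L])
    show "linear (L p)" for p
      by (rule linearI) (simp_all add: L_def corner_add corner_scaleR split: prod.split)
  next
    fix s t assume st: "s < r" "t < r" and e: "\<And>p. L p (v s) = L p (v t)"
    have "c s i j = c t i j" if "i \<le> n" "j \<le> n" for i j
      using e[of "(i, j)"] st that by (simp add: L_def cv)
    then show "v s = v t"
      by (auto simp: fun_eq_iff v_def entries_def restrict0_def square_def)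
  next
    fix p s t assume st: "Suc t < r" "s \<le> t" and n: "L p (v (Suc t)) \<noteq> L p (v t)"
    obtain i j where p: "p = (i, j)" by force
    show "L p (v s) = L p (v t)"
      using rnd_changes_once[OF st] n st by (simp add: L_def p cv) (simp add: c_def)
  qed
qed

section \<open>Passing to restrictions\<close>

text \<open>Integrality of the coefficients is expressed as preservation of the lattice. The choice
  of \<open>l\<close> and \<open>b\<close> is uniform in \<open>x\<close>, so the identity extends
  to the convex hull.\<close>

definition determined :: "symmetry_class \<Rightarrow> nat \<Rightarrow> (nat \<times> nat) set \<Rightarrow> nat \<times> nat \<Rightarrow> bool"
  where "determined X n I p \<longleftrightarrow> (\<exists>l b. linear l \<and> (\<forall>w\<in>int_lattice I. l w \<in> \<int>) \<and> b \<in> \<int> \<and>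
    (\<forall>x\<in>XASMs X n. x p = b + l (restrict0 I x)))"

lemma linear_restrict0: "linear (restrict0 I :: ('i \<Rightarrow> real) \<Rightarrow> 'i \<Rightarrow> real)"
  by (rule linearI) (auto simp: restrict0_def scaleR_fun_def fun_eq_iff)

text \<open>A dependence among the images pulls back: in each coordinate, \<open>l\<close> is
  applied to the vanishing combination, and \<open>b\<close> drops out because the coefficients sum
  to zero.\<close>

lemma affine_independent_image:
  fixes W :: "('i \<Rightarrow> real) set" and h :: "('i \<Rightarrow> real) \<Rightarrow> 'b::real_vector"
  assumes "finite W" "\<not> affine_dependent W"
    and "\<And>p. \<exists>l b. linear l \<and> (\<forall>v\<in>W. v p = b + l (h v))"
  shows "\<not> affine_dependent (h ` W)"
proof
  assume "affine_dependent (h ` W)"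
  then obtain U where U: "sum U (h ` W) = 0" "\<exists>v\<in>h ` W. U v \<noteq> 0" "(\<Sum>v\<in>h ` W. U v *\<^sub>R v) = 0"
    using assms(1) by (auto simp: affine_dependent_explicit_finite)
  \<comment> \<open>Every coordinate of \<open>v\<close> can be recovered from \<open>h v\<close>,
    so sums over the image can be reindexed by \<open>W\<close>.\<close>
  have inj: "inj_on h W"
  proof (rule inj_onI, rule ext)
    fix x y p assume xy: "x \<in> W" "y \<in> W" "h x = h y"
    obtain l b where "\<forall>v\<in>W. v p = b + l (h v)" using assms(3)[of p] by blast
    then have "x p = b + l (h x)" "y p = b + l (h y)" using xy by blast+
    then show "x p = y p" using xy(3) by simp
  qed
  have s: "(\<Sum>v\<in>W. U (h v)) = 0" "(\<Sum>v\<in>W. U (h v) *\<^sub>R h v) = 0"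
    using U(1,3) by (simp_all add: sum.reindex[OF inj])
  have "(\<Sum>v\<in>W. U (h v) *\<^sub>R v) p = 0" for p
  proof -
    obtain l b where l: "linear l" "\<forall>v\<in>W. v p = b + l (h v)" using assms(3) by blast
    have "(\<Sum>v\<in>W. U (h v) *\<^sub>R v) p = (\<Sum>v\<in>W. U (h v) * (b + l (h v)))"
      using l(2) by (simp add: sum_fun_apply scaleR_fun_def)
    also have "\<dots> = (\<Sum>v\<in>W. U (h v)) * b + l (\<Sum>v\<in>W. U (h v) *\<^sub>R h v)"
      by (simp add: distrib_left sum.distrib sum_distrib_right linear_sum[OF l(1)] linear_scale[OF l(1)])
    finally show ?thesis using s l(1) by (simp add: linear_0)
  qed
  then have "(\<Sum>v\<in>W. U (h v) *\<^sub>R v) = 0" by (simp add: fun_eq_iff)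
  moreover have "\<exists>v\<in>W. U (h v) \<noteq> 0" using U(2) by auto
  ultimately have "affine_dependent W"
    unfolding affine_dependent_explicit_finite[OF assms(1)]
    using s(1) by (intro exI[of _ "\<lambda>v. U (h v)"]) simp
  then show False using assms(2) by blast
qed

text \<open>Different \<open>t\<close> may give the same rounding; collecting equal terms produces
  the positive integer coefficients.\<close>

lemma sum_multiplicities:
  fixes w :: "nat \<Rightarrow> 'a::real_vector" and r :: nat
  defines "m \<equiv> \<lambda>u. card {t\<in>{..<r}. w t = u}"
  shows "(\<Sum>t<r. w t) = (\<Sum>u\<in>w ` {..<r}. real (m u) *\<^sub>R u)" "(\<Sum>u\<in>w ` {..<r}. m u) = r"
    "u \<in> w ` {..<r} \<Longrightarrow> m u > 0"
proof -
  have "(\<Sum>t<r. w t) = (\<Sum>u\<in>w ` {..<r}. \<Sum>t\<in>{t\<in>{..<r}. w t = u}. w t)"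
    by (rule sum.image_gen) simp
  also have "\<dots> = (\<Sum>u\<in>w ` {..<r}. \<Sum>t\<in>{t\<in>{..<r}. w t = u}. u)"
    by (intro sum.cong) auto
  finally show "(\<Sum>t<r. w t) = (\<Sum>u\<in>w ` {..<r}. real (m u) *\<^sub>R u)"
    by (simp add: m_def scaleR_conv_of_real sum_constant_scaleR)
  have "(\<Sum>t<r. 1::nat) = (\<Sum>u\<in>w ` {..<r}. \<Sum>t\<in>{t\<in>{..<r}. w t = u}. 1)"
    by (rule sum.image_gen) simp
  then show "(\<Sum>u\<in>w ` {..<r}. m u) = r" by (simp add: m_def)
  show "m u > 0" if "u \<in> w ` {..<r}"
    unfolding m_def using that by (auto simp: card_gt_0_iff)
qed

text \<open>An integer point of the dilated restricted polytope lifts to a point \<open>r q\<close>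
  over the full one. This lift is integral because its entries are integer affine functions of the
  given coordinates, so it can be decomposed there and restricted again.\<close>

lemma caratheodory_if_determined:
  assumes "n > 0" "\<And>p. p \<in> square n \<Longrightarrow> determined X n I p"
  shows "integer_caratheodory I (convex hull (restrict0 I ` XASMs X n))"
  unfolding integer_caratheodory_def
proof (intro allI impI ballI)
  let ?Q = "convex hull (restrict0 I ` XASMs X n)"
  fix r :: nat and x :: matr
  assume r: "r > 0" and x: "x \<in> (\<lambda>q. real r *\<^sub>R q) ` ?Q \<inter> int_lattice I"
  have "?Q = restrict0 I ` P_full X n"
    unfolding P_full_def by (rule convex_hull_linear_image[OF linear_restrict0, symmetric])
  then obtain q where q: "q \<in> P_full X n" and xq: "x = real r *\<^sub>R restrict0 I q" using x by auto
  \<comment> \<open>An affine identity valid on the matrices of the class holds on their convex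
    hull.\<close>
  have aff: "q p = b + l (restrict0 I q)"
    if "linear l" "\<forall>x\<in>XASMs X n. x p = b + l (restrict0 I x)" for p b and l :: "matr \<Rightarrow> real"
  proof -
    have lin: "l (restrict0 I (u *\<^sub>R x + w *\<^sub>R y)) = u * l (restrict0 I x) + w * l (restrict0 I y)"
      for u w x y
      by (simp add: linear_add[OF linear_restrict0] linear_scale[OF linear_restrict0]
          linear_add[OF that(1)] linear_scale[OF that(1)])
    have "convex {z. z p = b + l (restrict0 I z)}"
      unfolding convex_def
    proof (intro ballI allI impI)
      fix x y :: matr and u v :: real
      assume a: "x \<in> {z. z p = b + l (restrict0 I z)}" "y \<in> {z. z p = b + l (restrict0 I z)}" "u + v = 1"
      have "u * b + v * b = b" using a(3) by (simp flip: distrib_right)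
      then show "u *\<^sub>R x + v *\<^sub>R y \<in> {z. z p = b + l (restrict0 I z)}"
        using a(1,2) by (simp add: lin) (simp add: scaleR_fun_def algebra_simps)
    qed
    then have "P_full X n \<subseteq> {z. z p = b + l (restrict0 I z)}"
      unfolding P_full_def using that(2) by (intro hull_minimal) auto
    then show ?thesis using q by auto
  qed
  have "(real r *\<^sub>R q) p \<in> \<int>" if p: "p \<in> square n" for p
  proof -
    obtain l b where l: "linear l" "\<forall>w\<in>int_lattice I. l w \<in> \<int>" "b \<in> \<int>"
        "\<forall>x\<in>XASMs X n. x p = b + l (restrict0 I x)"
      using assms(2)[OF p] unfolding determined_def by blast
    \<comment> \<open>Dilation multiplies the constant by \<open>r\<close> too; it stays an
      integer.\<close>
    have "(real r *\<^sub>R q) p = real r * b + l x"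
      unfolding xq linear_scale[OF l(1)] using aff[OF l(1,4)] by (simp add: scaleR_fun_def distrib_left)
    moreover have "l x \<in> \<int>" using l(2) x by blast
    ultimately show ?thesis using l(3) by simp
  qed
  moreover have "(real r *\<^sub>R q) p = 0" if "p \<notin> square n" for p
    using P_full_height(2)[OF assms(1) q that] by (simp add: scaleR_fun_def)
  ultimately have "real r *\<^sub>R q \<in> int_lattice (square n)" by (auto simp only: int_lattice_def mem_Collect_eq)
  then obtain v where v: "\<And>t. t < r \<Longrightarrow> v t \<in> XASMs X n" "(\<Sum>t<r. v t) = real r *\<^sub>R q"
      "\<not> affine_dependent (v ` {..<r})"
    using XASM_decomposition[OF assms(1) r q] by metis
  define w where "w = (\<lambda>t. restrict0 I (v t))"
  have xw: "x = (\<Sum>t<r. w t)"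
    unfolding w_def xq linear_sum[OF linear_restrict0, symmetric] v(2)
    by (simp add: linear_scale[OF linear_restrict0])
  have "\<not> affine_dependent (restrict0 I ` (v ` {..<r}))"
  proof (rule affine_independent_image[OF _ v(3)])
    fix p
    show "\<exists>l b. linear l \<and> (\<forall>v\<in>v ` {..<r}. v p = b + l (restrict0 I v))"
    proof (cases "p \<in> square n")
      case True
      then obtain l b where "linear l" "\<forall>x\<in>XASMs X n. x p = b + l (restrict0 I x)"
        using assms(2) unfolding determined_def by blast
      then show ?thesis using v(1) by (intro exI[of _ l] exI[of _ b]) auto
    next
      case False
      then have "v t p = 0" if "t < r" for t
        using v(1)[OF that] unfolding XASMs_def is_ASM_def by blast
      then show ?thesis by (intro exI[of _ "\<lambda>_. 0"] exI[of _ 0]) (auto simp: linear_zero)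
    qed
  qed simp
  then have "\<not> affine_dependent (w ` {..<r})" by (simp add: w_def image_image)
  moreover have "w t \<in> ?Q \<inter> int_lattice I" if "t < r" for t
  proof
    show "w t \<in> ?Q" unfolding w_def using v(1)[OF that] by (intro hull_inc imageI)
    have "v t \<in> int_lattice (square n)" using v(1)[OF that] by (simp add: XASMs_def is_ASM_iff)
    then show "w t \<in> int_lattice I"
      using int_lattice_Ints unfolding w_def int_lattice_def[of I] restrict0_def by auto
  qed
  ultimately show "\<exists>V c. finite V \<and> V \<subseteq> ?Q \<inter> int_lattice I \<and> \<not> affine_dependent V \<and>
      (\<forall>v\<in>V. 0 < c v) \<and> x = (\<Sum>v\<in>V. real (c v) *\<^sub>R v) \<and> sum c V = r"
    using sum_multiplicities[where w = w and r = r] unfolding xw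
    by (intro exI[of _ "w ` {..<r}"] exI[of _ "\<lambda>u. card {t\<in>{..<r}. w t = u}"]) blast
qed

section \<open>Core entries determine the whole matrix\<close>

lemma determined_core: "p \<in> I \<Longrightarrow> determined X n I p"
  unfolding determined_def
  by (rule exI[of _ "\<lambda>w. w p"], rule exI[of _ 0])
    (auto simp: int_lattice_def restrict0_def scaleR_fun_def intro!: linearI)

lemma determined_cong:
  assumes "determined X n I p" "\<And>x. x \<in> XASMs X n \<Longrightarrow> x p' = x p"
  shows "determined X n I p'"
  using assms unfolding determined_def by metis

text \<open>Meant for a line sum equal to 1: the last missing entry of a row or column is an integer
  affine function of the others.\<close>

lemma determined_complement:
  assumes "finite S" "\<And>p. p \<in> S \<Longrightarrow> determined X n I p"
    and "\<And>x. x \<in> XASMs X n \<Longrightarrow> x p' = 1 - (\<Sum>p\<in>S. x p)"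
  shows "determined X n I p'"
proof -
  \<comment> \<open>Linear part and constant are packed into a pair so that one choice function
    delivers both.\<close>
  have "\<forall>p\<in>S. \<exists>lb. linear (fst lb) \<and> (\<forall>w\<in>int_lattice I. fst lb w \<in> \<int>) \<and> snd lb \<in> \<int> \<and>
    (\<forall>x\<in>XASMs X n. x p = snd lb + fst lb (restrict0 I x))"
    using assms(2) unfolding determined_def by (metis fst_conv snd_conv)
  then obtain f where f: "\<And>p. p \<in> S \<Longrightarrow> linear (fst (f p)) \<and> (\<forall>w\<in>int_lattice I. fst (f p) w \<in> \<int>) \<and>
    snd (f p) \<in> \<int> \<and> (\<forall>x\<in>XASMs X n. x p = snd (f p) + fst (f p) (restrict0 I x))"
    by (metis (no_types, lifting) bchoice)
  have "linear (\<lambda>w. - (\<Sum>p\<in>S. fst (f p) w))"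
    using f by (intro linear_compose_neg linear_compose_sum) auto
  moreover have "- (\<Sum>p\<in>S. fst (f p) w) \<in> \<int>" if "w \<in> int_lattice I" for w
    using f that by (intro Ints_minus Ints_sum) blast
  moreover have "1 - (\<Sum>p\<in>S. snd (f p)) \<in> \<int>"
    using f by (intro Ints_diff Ints_1 Ints_sum) blast
  moreover have "x p' = 1 - (\<Sum>p\<in>S. snd (f p)) + - (\<Sum>p\<in>S. fst (f p) (restrict0 I x))"
    if "x \<in> XASMs X n" for x
  proof -
    have "(\<Sum>p\<in>S. x p) = (\<Sum>p\<in>S. snd (f p) + fst (f p) (restrict0 I x))"
      using f that by (intro sum.cong) auto
    then show ?thesis using assms(3)[OF that] by (simp add: sum.distrib)
  qed
  ultimately show ?thesis unfolding determined_def by blast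
qed

lemma determined_row:
  assumes "i \<in> {1..n}" "j \<in> {1..n}" "\<And>j'. j' \<in> {1..n} \<Longrightarrow> j' \<noteq> j \<Longrightarrow> determined X n I (i, j')"
  shows "determined X n I (i, j)"
proof (rule determined_complement[of "Pair i ` ({1..n} - {j})"])
  fix x assume "x \<in> XASMs X n"
  then have "(\<Sum>j=1..n. x (i, j)) = 1" using assms(1) by (simp add: XASMs_def is_ASM_iff)
  moreover have "(\<Sum>p\<in>Pair i ` ({1..n} - {j}). x p) = (\<Sum>j\<in>{1..n} - {j}. x (i, j))"
    by (rule sum.reindex_cong[of "Pair i"]) (auto simp: inj_on_def)
  ultimately show "x (i, j) = 1 - (\<Sum>p\<in>Pair i ` ({1..n} - {j}). x p)"
    using sum.remove[of "{1..n}" j "\<lambda>j. x (i, j)"] assms(2) by simp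
qed (use assms(3) in \<open>simp, blast\<close>)

lemma determined_col:
  assumes "i \<in> {1..n}" "j \<in> {1..n}" "\<And>i'. i' \<in> {1..n} \<Longrightarrow> i' \<noteq> i \<Longrightarrow> determined X n I (i', j)"
  shows "determined X n I (i, j)"
proof (rule determined_complement[of "(\<lambda>i. (i, j)) ` ({1..n} - {i})"])
  fix x assume "x \<in> XASMs X n"
  then have "(\<Sum>i=1..n. x (i, j)) = 1" using assms(2) by (simp add: XASMs_def is_ASM_iff)
  moreover have "(\<Sum>p\<in>(\<lambda>i. (i, j)) ` ({1..n} - {i}). x p) = (\<Sum>i\<in>{1..n} - {i}. x (i, j))"
    by (rule sum.reindex_cong[of "\<lambda>i. (i, j)"]) (auto simp: inj_on_def)
  ultimately show "x (i, j) = 1 - (\<Sum>p\<in>(\<lambda>i. (i, j)) ` ({1..n} - {i}). x p)"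
    using sum.remove[of "{1..n}" i "\<lambda>i. x (i, j)"] assms(1) by simp
qed (use assms(3) in \<open>simp, blast\<close>)

lemma determined_sym:
  assumes "i \<in> {1..n}" "j \<in> {1..n}"
  shows "vsym X \<Longrightarrow> determined X n I (i, n + 1 - j) \<Longrightarrow> determined X n I (i, j)"
    "hsym X \<Longrightarrow> determined X n I (n + 1 - i, j) \<Longrightarrow> determined X n I (i, j)"
    "tsym X \<Longrightarrow> determined X n I (j, i) \<Longrightarrow> determined X n I (i, j)"
    "rsym X \<Longrightarrow> determined X n I (n + 1 - i, n + 1 - j) \<Longrightarrow> determined X n I (i, j)"
proof -
  have S: "(vsym X \<longrightarrow> x (i, n + 1 - j) = x (i, j)) \<and> (hsym X \<longrightarrow> x (n + 1 - i, j) = x (i, j)) \<and>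
    (tsym X \<longrightarrow> x (j, i) = x (i, j)) \<and> (rsym X \<longrightarrow> x (n + 1 - i, n + 1 - j) = x (i, j))"
    if "x \<in> XASMs X n" for x
    using that assms unfolding XASMs_def mem_Collect_eq has_symmetry_iff by blast
  show "determined X n I (i, j)" if "vsym X" "determined X n I (i, n + 1 - j)"
    using that(2) by (rule determined_cong) (use S that(1) in metis)
  show "determined X n I (i, j)" if "hsym X" "determined X n I (n + 1 - i, j)"
    using that(2) by (rule determined_cong) (use S that(1) in metis)
  show "determined X n I (i, j)" if "tsym X" "determined X n I (j, i)"
    using that(2) by (rule determined_cong) (use S that(1) in metis)
  show "determined X n I (i, j)" if "rsym X" "determined X n I (n + 1 - i, n + 1 - j)"
    using that(2) by (rule determined_cong) (use S that(1) in metis)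
qed

text \<open>Reflection gives the right half of the row, and the row sum gives the middle
  entry.\<close>

lemma determined_if_left_half:
  assumes "vsym X" "odd n" "i \<in> {1..n}" "\<And>j. j \<in> {1..n div 2} \<Longrightarrow> determined X n I (i, j)"
    and "j \<in> {1..n}"
  shows "determined X n I (i, j)"
proof -
  have off: "determined X n I (i, j)" if j: "j \<in> {1..n}" "j \<noteq> n div 2 + 1" for j
  proof (cases "j \<le> n div 2")
    case False
    then have "n + 1 - j \<in> {1..n div 2}" using j assms(2) by auto
    then show ?thesis using determined_sym(1)[OF assms(3) j(1) assms(1)] assms(4) by blast
  qed (use assms(4) j in simp)
  show ?thesis
  proof (cases "j = n div 2 + 1")
    case True
    then show ?thesis by (intro determined_row[OF assms(3,5)] off) auto
  qed (use off assms(5) in blast)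
qed

text \<open>The upper rows are completed first, then reflected downwards; column sums supply the
  middle row.\<close>

lemma determined_if_quadrant:
  assumes "vsym X" "hsym X" "odd n"
    and "\<And>i j. i \<in> {1..n div 2} \<Longrightarrow> j \<in> {1..n div 2} \<Longrightarrow> determined X n I (i, j)"
    and ij: "i \<in> {1..n}" "j \<in> {1..n}"
  shows "determined X n I (i, j)"
proof -
  have top: "determined X n I (i, j)" if "i \<in> {1..n div 2}" "j \<in> {1..n}" for i j
    by (rule determined_if_left_half[OF assms(1,3)]) (use assms(4) that in auto)
  have off: "determined X n I (i, j)" if i: "i \<in> {1..n}" "i \<noteq> n div 2 + 1" and j: "j \<in> {1..n}" for i j
  proof (cases "i \<le> n div 2")
    case False
    then have "n + 1 - i \<in> {1..n div 2}" using i assms(3) by auto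
    then show ?thesis using determined_sym(2)[OF i(1) j assms(2)] top j by blast
  qed (use top i j in simp)
  show ?thesis
  proof (cases "i = n div 2 + 1")
    case True
    then show ?thesis by (intro determined_col[OF ij] off) (use ij in auto)
  qed (use off ij in blast)
qed

lemma odd_if_vsym:
  assumes "n > 0" "XASMs X n \<noteq> {}" "vsym X"
  shows "odd n"
  using assms height_if_XASM heightD(7) by blast

lemma core_determines:
  assumes "n > 0" "XASMs X n \<noteq> {}" "p \<in> square n"
  shows "determined X n (core X n) p"
proof -
  obtain i j where p: "p = (i, j)" and ij: "i \<in> {1..n}" "j \<in> {1..n}"
    using assms(3) by (auto simp: square_def)
  note odd = odd_if_vsym[OF assms(1,2)]
  show ?thesis
    unfolding p
  proof (cases X)
    case ASM
    then show "determined X n (core X n) (i, j)" using ij by (intro determined_core) (simp add: square_def)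
  next
    case VSASM
    then have "vsym X" by (simp add: sym_defs)
    then show "determined X n (core X n) (i, j)"
      by (rule determined_if_left_half[OF _ odd[OF \<open>vsym X\<close>] ij(1) _ ij(2)])
        (use ij VSASM in \<open>auto intro: determined_core\<close>)
  next
    case VHSASM
    then have X: "vsym X" "hsym X" by (simp_all add: sym_defs)
    show "determined X n (core X n) (i, j)"
      by (rule determined_if_quadrant[OF X odd[OF X(1)] _ ij])
        (use VHSASM in \<open>auto intro: determined_core\<close>)
  next
    case TSASM
    then have X: "vsym X" "hsym X" "tsym X" by (simp_all add: sym_defs)
    show "determined X n (core X n) (i, j)"
    proof (rule determined_if_quadrant[OF X(1,2) odd[OF X(1)] _ ij])
      fix i j assume a: "i \<in> {1..n div 2}" "j \<in> {1..n div 2}"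
      then have b: "i \<in> {1..n}" "j \<in> {1..n}" by auto
      have "(i, j) \<in> core X n \<or> (j, i) \<in> core X n" using a TSASM by auto
      then show "determined X n (core X n) (i, j)"
        using determined_sym(3)[OF b X(3)] determined_core by blast
    qed
  next
    case DSASM
    then have X: "tsym X" by (simp add: sym_defs)
    have "(i, j) \<in> core X n \<or> (j, i) \<in> core X n" using ij DSASM by auto
    then show "determined X n (core X n) (i, j)"
      using determined_sym(3)[OF ij X] determined_core by blast
  next
    case HTSASM
    then have X: "rsym X" by (simp add: sym_defs)
    \<comment> \<open>For odd \<open>n\<close> the centre is fixed by the half-turn and lies outside
      the core. All other positions are in the core or are sent into it; the centre then follows
      from its column sum.\<close>
    have off: "determined X n (core X n) (i, j)"
      if "i \<in> {1..n}" "j \<in> {1..n}" "odd n \<longrightarrow> (i, j) \<noteq> (n div 2 + 1, n div 2 + 1)" for i j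
    proof -
      have "(i, j) \<in> core X n \<or> (n + 1 - i, n + 1 - j) \<in> core X n"
      proof (cases "j \<le> n div 2 \<or> n + 1 - j \<le> n div 2")
        case True
        then show ?thesis using that HTSASM by auto
      next
        case False
        \<comment> \<open>Only the middle column is left, whose upper half belongs to the
          core.\<close>
        then have "odd n" "j = n div 2 + 1" using that by presburger+
        moreover from this have "n + 1 - j = n div 2 + 1" by presburger
        moreover have "i \<le> n div 2 \<or> n + 1 - i \<le> n div 2" using that \<open>odd n\<close> \<open>j = n div 2 + 1\<close> by auto
        ultimately show ?thesis using that HTSASM by auto
      qed
      then show ?thesis using determined_sym(4)[OF that(1,2) X] determined_core by blast
    qed
    show "determined X n (core X n) (i, j)"
    proof (cases "(i, j) = (n div 2 + 1, n div 2 + 1)")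
      case True
      then show ?thesis by (intro determined_col[OF ij] off) (use ij in auto)
    qed (use off ij in blast)
  next
    case DASASM
    then have X: "tsym X" "rsym X" by (simp_all add: sym_defs)
    \<comment> \<open>The core is the top triangle between the two diagonals, boundary included.
      Away from the centre the inequalities force \<open>2 * a \<le> n\<close>, hence
      \<open>a \<le> n div 2\<close>.\<close>
    have mem: "(a, b) \<in> core X n" if "1 \<le> a" "a \<le> b" "a + b \<le> n + 1" "a \<noteq> b \<or> a + b \<noteq> n + 1" for a b
    proof -
      have "a \<le> n div 2" "b \<le> n" "b \<le> n + 1 - a" using that by linarith+
      then show ?thesis using that by (simp add: DASASM)
    qed
    have off: "determined X n (core X n) (i, j)"
      if ij: "i \<in> {1..n}" "j \<in> {1..n}" and ne: "i \<noteq> j \<or> i + j \<noteq> n + 1" for i j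
    proof -
      have r: "n + 1 - i \<in> {1..n}" "n + 1 - j \<in> {1..n}" using ij by auto
      \<comment> \<open>The diagonals cut the square into four triangles, each of which is carried
        onto the top one by a symmetry of the class.\<close>
      consider "i \<le> j" "i + j \<le> n + 1" | "j \<le> i" "i + j \<le> n + 1"
        | "i \<le> j" "i + j \<ge> n + 1" | "j \<le> i" "i + j \<ge> n + 1" by linarith
      then have "(i, j) \<in> core X n \<or> (j, i) \<in> core X n \<or> (n + 1 - i, n + 1 - j) \<in> core X n \<or>
        (n + 1 - j, n + 1 - i) \<in> core X n"
      proof cases
        case 1
        then have "(i, j) \<in> core X n" using ij ne by (intro mem) auto
        then show ?thesis by blast
      next
        case 2
        then have "(j, i) \<in> core X n" using ij ne by (intro mem) auto
        then show ?thesis by blast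
      next
        case 3
        then have "(n + 1 - j, n + 1 - i) \<in> core X n" using r ij ne by (intro mem) auto
        then show ?thesis by blast
      next
        case 4
        then have "(n + 1 - i, n + 1 - j) \<in> core X n" using r ij ne by (intro mem) auto
        then show ?thesis by blast
      qed
      then show ?thesis
        using determined_sym(3)[OF ij X(1)] determined_sym(4)[OF ij X(2)]
          determined_sym(3)[OF r X(1)] determined_core by blast
    qed
    show "determined X n (core X n) (i, j)"
    proof (cases "i \<noteq> j \<or> i + j \<noteq> n + 1")
      case False
      \<comment> \<open>Only the centre remains, and all other entries of its row are known.\<close>
      then show ?thesis by (intro determined_row[OF ij] off) (use ij in auto)
    qed (use off ij in blast)
  qed
qed

theorem corollary10p3:
  fixes X :: symmetry_class and n :: nat
  assumes "n > 0" and "XASMs X n \<noteq> {}"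
  shows "integer_caratheodory (square n) (P_full X n) \<and>
    (X \<noteq> ASM \<longrightarrow> integer_caratheodory (core X n) (P_core X n)) \<and>
    integer_decomposition (square n) (P_full X n) \<and>
    (X \<noteq> ASM \<longrightarrow> integer_decomposition (core X n) (P_core X n))"
proof -
  \<comment> \<open>The full polytope is the case \<open>I = square n\<close> of
    \<open>caratheodory_if_determined\<close>, where restriction does nothing.\<close>
  have "restrict0 (square n) x = x" if "x \<in> XASMs X n" for x
    using that unfolding restrict0_def XASMs_def is_ASM_def by force
  then have "restrict0 (square n) ` XASMs X n = XASMs X n" by simp
  then have "integer_caratheodory (square n) (P_full X n)"
    using caratheodory_if_determined[OF assms(1), of X "square n"] determined_core by (simp add: P_full_def)
  moreover have "integer_caratheodory (core X n) (P_core X n)"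
    unfolding P_core_def by (intro caratheodory_if_determined core_determines assms)
  ultimately show ?thesis using decomposition_if_caratheodory by blast
qed

end
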